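(* Let $\alpha>0$ and let $X=(X_1,\dots,X_n)$ be an $\alpha$-permanental vector with non-singular kernel $K$. Assume that $A=K^{-1}$ is a nonsingular $M$-matrix with diagonal entries $(a_1,\dots,a_n)$. Then there exists a coupling between $X$ and an $n$-tuple $(\xi^{(1)}_{\alpha,1},\dots,\xi^{(n)}_{\alpha,1})$ of independent identically distributed copies of $\xi_{\alpha,1}$ such that, almost surely, $$X\ \ge\ \left(a_1^{-1}\xi^{(1)}_{\alpha,1},\dots,a_n^{-1}\xi^{(n)}_{\alpha,1}\right),$$ where the inequality is coordinatewise.
   Context: For $\alpha>0$ and a real $n\times n$ matrix $K$, an $\alpha$-permanental vector with kernel $K$ is a random vector $X=(X_1,\dots,X_n)$ with non-negative components such that $E\left(e^{-\sum_{i=1}^n s_iX_i}\right)=|I+KS|^{-\alpha}$ for all $s_1,\dots,s_n\ge 0$, where $S$ is the diagonal matrix with entries $s_1,\dots,s_n$ and $|\cdot|$ denotes the determinant. A real $n\times n$ matrix $A=(a_{i,j})$ is a nonsingular $M$-matrix if $a_{i,j}\le 0$ for all $i\ne j$, $A$ is nonsingular, and all entries of $A^{-1}$ are $\ge 0$. For $u,v>0$, $\xi_{u,v}$ denotes a gamma random variable with shape $u$ and scale parameter $v$, i.e. with density $v^u x^{u-1}e^{-vx}/\Gamma(u)$ on $x>0$. A coupling of $X$ and a random vector $Y$ is a pair of random vectors on a common probability space whose first (second) component has the law of $X$ (of $Y$). *)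

theory Defs
  imports "HOL-Probability.Probability"
begin

definition diag_matrix :: "real ^ 'n \<Rightarrow> real ^ 'n ^ 'n" where
  "diag_matrix s = (\<chi> i j. if i = j then s $ i else 0)"

text \<open>
  The real power in the Laplace transform needs no separate positivity condition on the
  determinant: it equals 1 at s = 0, depends continuously on s, and cannot vanish for s \<ge> 0,
  since the left-hand side is positive while 0 powr a = 0.
\<close>

definition permanental_vector ::
    "real \<Rightarrow> real ^ 'n ^ 'n \<Rightarrow> 'a measure \<Rightarrow> ('a \<Rightarrow> real ^ 'n) \<Rightarrow> bool" where
  "permanental_vector \<alpha> K M X \<longleftrightarrow>
     prob_space M \<and> X \<in> borel_measurable M \<and>
     (AE \<omega> in M. \<forall>i. 0 \<le> X \<omega> $ i) \<and>
     (\<forall>s. (\<forall>i. 0 \<le> s $ i) \<longrightarrow>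
        prob_space.expectation M (\<lambda>\<omega>. exp (- (\<Sum>i\<in>UNIV. s $ i * X \<omega> $ i)))
          = det (mat 1 + K ** diag_matrix s) powr (- \<alpha>))"

definition nonsingular_M_matrix :: "real ^ 'n ^ 'n \<Rightarrow> bool" where
  "nonsingular_M_matrix A \<longleftrightarrow>
     (\<forall>i j. i \<noteq> j \<longrightarrow> A $ i $ j \<le> 0) \<and> invertible A \<and>
     (\<forall>i j. 0 \<le> matrix_inv A $ i $ j)"

text \<open>The parameter v multiplies x in the exponential, i.e. it is an inverse scale.\<close>

definition gamma_density :: "real \<Rightarrow> real \<Rightarrow> real \<Rightarrow> real" where
  "gamma_density u v x =
     (if 0 < x then v powr u * x powr (u - 1) * exp (- (v * x)) / Gamma u else 0)"

definition iid_gamma ::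
    "real \<Rightarrow> real \<Rightarrow> 'a measure \<Rightarrow> ('n \<Rightarrow> 'a \<Rightarrow> real) \<Rightarrow> bool" where
  "iid_gamma u v N \<xi> \<longleftrightarrow>
     prob_space N \<and> prob_space.indep_vars N (\<lambda>_. borel) \<xi> UNIV \<and>
     (\<forall>i. distributed N lborel (\<xi> i) (\<lambda>x. ennreal (gamma_density u v x)))"

text \<open>X' and Y', on the common space P, couple X (living on M) and Y (living on N).\<close>

definition coupling ::
    "'a measure \<Rightarrow> ('a \<Rightarrow> 'c::topological_space) \<Rightarrow> 'b measure \<Rightarrow> ('b \<Rightarrow> 'd::topological_space) \<Rightarrow>
     'p measure \<Rightarrow> ('p \<Rightarrow> 'c) \<Rightarrow> ('p \<Rightarrow> 'd) \<Rightarrow> bool" where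
  "coupling M X N Y P X' Y' \<longleftrightarrow>
     prob_space P \<and> X' \<in> borel_measurable P \<and> Y' \<in> borel_measurable P \<and>
     distr P borel X' = distr M borel X \<and> distr P borel Y' = distr N borel Y"

end

theory Submission
  imports Defs
begin

text \<open>
  Write \<open>A = D (I - C)\<close> with \<open>D\<close> the diagonal of \<open>A\<close> and \<open>C \<ge> 0\<close>, put \<open>z\<^sub>i = 1 / (1 + s\<^sub>i / a\<^sub>i)\<close> and let
  \<open>Z\<close> be the diagonal matrix of \<open>z\<close>. Then the Laplace transform of \<open>X\<close> is
  \<open>(\<Prod>i. z\<^sub>i powr \<alpha>) * exp (\<alpha> L(z) - \<alpha> L(1))\<close> with
  \<open>L(z) = - log det (I - Z C) = (\<Sum>k\<ge>1. trace ((Z C)^k) / k)\<close>, a power series in \<open>z\<close> with non-negative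
  coefficients. Hence the second factor is \<open>E (\<Prod>i. z\<^sub>i ^ k\<^sub>i)\<close> for a random multi-index \<open>k\<close>, which is the
  transform of a vector \<open>\<eta> \<ge> 0\<close> whose coordinates are, given \<open>k\<close>, independent gamma variables with shapes
  \<open>k\<^sub>i\<close> and inverse scales \<open>a\<^sub>i\<close>. The first factor is the transform of \<open>(\<xi>\<^sub>i / a\<^sub>i)\<close>, so by uniqueness of
  Laplace transforms \<open>X\<close> has the law of \<open>(\<xi>\<^sub>i / a\<^sub>i + \<eta>\<^sub>i)\<close> with \<open>\<xi>\<close> and \<open>\<eta>\<close> independent.
\<close>

section \<open>The determinant of I minus a non-negative matrix\<close>

text \<open>On vectors \<open>*\<close> acts componentwise, so \<open>M ^ k\<close> would take
  entrywise powers; matrix powers are iterates of \<open>**\<close>.\<close>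

definition mpow :: "'a::semiring_1^'n^'n \<Rightarrow> nat \<Rightarrow> 'a^'n^'n" where
  "mpow M k = ((**) M ^^ k) (mat 1)"

lemma mpow_0 [simp]: "mpow M 0 = mat 1"
  and mpow_Suc: "mpow M (Suc k) = M ** mpow M k"
  by (simp_all add: mpow_def)

lemma mpow_commute: "mpow M k ** M = M ** mpow M k"
  by (induction k) (simp_all add: mpow_Suc matrix_mul_assoc[symmetric])

lemma mpow_scaleR:
  fixes M :: "real^'n^'n"
  shows "mpow (t *\<^sub>R M) k = t ^ k *\<^sub>R mpow M k"
  by (induction k) (simp_all add: mpow_Suc scalar_matrix_assoc[symmetric] matrix_scalar_ac mult.commute)

lemma matrix_diff_ldistrib: "A ** (B - C) = A ** B - A ** (C :: 'a::ring_1^'n^'n)"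
  by (vector matrix_matrix_mult_def sum_subtractf right_diff_distrib)

lemma matrix_diff_rdistrib: "(B - C) ** A = B ** A - C ** (A :: 'a::ring_1^'n^'n)"
  by (vector matrix_matrix_mult_def sum_subtractf left_diff_distrib)

lemma mpow_nonneg:
  fixes M :: "real^'n^'n"
  assumes "\<And>i j. 0 \<le> M $ i $ j"
  shows "0 \<le> mpow M k $ i $ j"
proof (induction k arbitrary: i j)
  case (Suc k)
  show ?case
    unfolding mpow_Suc matrix_matrix_mult_def using Suc assms by (auto intro!: sum_nonneg)
qed (simp add: mat_def)

lemma mpow_mono:
  fixes M N :: "real^'n^'n"
  assumes "\<And>i j. 0 \<le> M $ i $ j" "\<And>i j. M $ i $ j \<le> N $ i $ j"
  shows "mpow M k $ i $ j \<le> mpow N k $ i $ j"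
proof (induction k arbitrary: i j)
  case (Suc k)
  have "0 \<le> N $ i $ j" for i j using assms order_trans by blast
  then show ?case
    unfolding mpow_Suc matrix_matrix_mult_def using Suc assms
    by (auto intro!: sum_mono mult_mono mpow_nonneg)
qed simp

text \<open>In the Leibniz expansion, differentiating factor \<open>i\<close> at
  \<open>h = 0\<close> leaves the other factors of the identity matrix, whose product vanishes
  unless \<open>p\<close> fixes every \<open>j\<close> other than \<open>i\<close>. Only
  \<open>p = id\<close> survives, and it yields minus the trace.\<close>

lemma has_derivative_det_mat_1_minus:
  fixes N :: "real^'n^'n"
  shows "((\<lambda>h. det (mat 1 - h *\<^sub>R N)) has_field_derivative - trace N) (at 0)"
proof -
  let ?m = "\<lambda>i j. mat 1 $ i $ j :: real"
  let ?P = "{p. p permutes (UNIV :: 'n set)}"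
  let ?d = "\<lambda>p. of_int (sign p) * (\<Sum>i\<in>UNIV. - N $ i $ p i * (\<Prod>j\<in>UNIV - {i}. ?m j (p j)))"
  have off: "?d p = 0" if "p \<in> ?P" "p \<noteq> id" for p
  proof -
    have "(\<Prod>j\<in>UNIV - {i}. ?m j (p j)) = 0" for i
    proof -
      \<comment> \<open>A permutation that fixes every point other than \<open>i\<close> fixes
        \<open>i\<close> as well, hence is \<open>id\<close>.\<close>
      have "\<exists>j. j \<noteq> i \<and> p j \<noteq> j"
      proof (rule ccontr)
        assume fix_all: "\<not> ?thesis"
        have "p i = i"
          using fix_all that(1) by (metis mem_Collect_eq permutes_inverses(2) permutes_def)
        with fix_all have "p = id" by (auto simp: fun_eq_iff)
        with that show False by simp
      qed
      then obtain j where "j \<noteq> i" "p j \<noteq> j" by blast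
      then show ?thesis
        by (intro prod_zero) (auto simp: mat_def intro!: bexI[of _ j])
    qed
    then have "?d p = of_int (sign p) * (\<Sum>i\<in>UNIV. 0)"
      by (intro arg_cong2[where f = "(*)"] sum.cong refl) (simp del: prod_zero_iff)
    then show ?thesis by simp
  qed
  have "((\<lambda>h. det (mat 1 - h *\<^sub>R N)) has_field_derivative (\<Sum>p\<in>?P. ?d p)) (at 0)"
    unfolding det_def
    by (rule DERIV_sum, rule DERIV_cmult)
       (rule has_field_derivative_prod[THEN DERIV_cong], auto intro!: derivative_eq_intros)
  also have "(\<Sum>p\<in>?P. ?d p) = ?d id"
    using off by (subst sum.remove[where x = id]) (auto simp: permutes_id)
  also have "\<dots> = - trace N"
    by (simp add: trace_def mat_def sum_negf sign_id)
  finally show ?thesis .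
qed

text \<open>Jacobi's formula at a general point \<open>t\<close>, reduced to the origin: with
  \<open>R\<close> the resolvent, \<open>I - u M = (I - t M) (I - (u - t) R M)\<close>, and the
  determinant is multiplicative.\<close>

lemma has_derivative_det_resolvent:
  fixes M R :: "real^'n^'n"
  assumes R: "(mat 1 - t *\<^sub>R M) ** R = mat 1"
  shows "((\<lambda>u. det (mat 1 - u *\<^sub>R M)) has_field_derivative
            - det (mat 1 - t *\<^sub>R M) * trace (R ** M)) (at t)"
proof -
  have eq: "det (mat 1 - u *\<^sub>R M) = det (mat 1 - t *\<^sub>R M) * det (mat 1 - (u - t) *\<^sub>R (R ** M))" for u
  proof -
    have "(mat 1 - t *\<^sub>R M) ** (mat 1 - (u - t) *\<^sub>R (R ** M))
        = (mat 1 - t *\<^sub>R M) - (u - t) *\<^sub>R (((mat 1 - t *\<^sub>R M) ** R) ** M)"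
      by (simp add: matrix_diff_ldistrib matrix_scalar_ac matrix_mul_assoc scalar_matrix_assoc)
    also have "\<dots> = mat 1 - u *\<^sub>R M" by (simp add: R algebra_simps)
    finally show ?thesis by (metis det_mul)
  qed
  have "((\<lambda>u. det (mat 1 - (u - t) *\<^sub>R (R ** M))) has_field_derivative - trace (R ** M)) (at t)"
    using has_derivative_det_mat_1_minus[of "R ** M"]
      DERIV_shift[of "\<lambda>u. det (mat 1 - (u - t) *\<^sub>R (R ** M))" _ 0 t] by simp
  from DERIV_cmult[OF this, of "det (mat 1 - t *\<^sub>R M)"] show ?thesis
    by (simp add: eq[symmetric])
qed

text \<open>Multiplying the series by \<open>M\<close> shifts its index by one, so
  \<open>M R = R - I\<close>. Convergence is required only entrywise, which is what the M-matrix
  property provides later.\<close>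

lemma neumann_series:
  fixes M :: "real^'n^'n"
  assumes "\<And>i j. summable (\<lambda>k. mpow M k $ i $ j)"
  shows "(mat 1 - M) ** (\<chi> i j. \<Sum>k. mpow M k $ i $ j) = mat 1"
proof -
  let ?R = "\<chi> i j. \<Sum>k. mpow M k $ i $ j"
  have "(M ** ?R) $ i $ j = ?R $ i $ j - mat 1 $ i $ j" for i j
  proof -
    have "(M ** ?R) $ i $ j = (\<Sum>l\<in>UNIV. \<Sum>k. M $ i $ l * mpow M k $ l $ j)"
      using assms by (simp add: matrix_matrix_mult_def suminf_mult)
    also have "\<dots> = (\<Sum>k. \<Sum>l\<in>UNIV. M $ i $ l * mpow M k $ l $ j)"
      using assms by (intro suminf_sum[symmetric] summable_mult)
    also have "\<dots> = (\<Sum>k. mpow M (Suc k) $ i $ j)"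
      by (simp add: mpow_Suc matrix_matrix_mult_def)
    also have "\<dots> = ?R $ i $ j - mat 1 $ i $ j"
      using suminf_split_head[OF assms[of i j]] by simp
    finally show ?thesis .
  qed
  then show ?thesis by (simp add: matrix_diff_rdistrib vec_eq_iff)
qed

lemma trace_scaleR: "trace (c *\<^sub>R M) = c * trace (M :: real^'n^'n)"
  by (simp add: trace_def sum_distrib_left)

text \<open>The function \<open>g t = det (I - t M) * exp (L t)\<close> is constant on [0,1]:
  Jacobi's formula and the Neumann series give it derivative 0 inside, and \<open>g 0 = 1\<close>.
  The product form makes sense before the determinant is known to be positive, unlike an identity
  for its logarithm.\<close>

lemma
  fixes M :: "real^'n^'n"
  assumes nonneg: "\<And>i j. 0 \<le> M $ i $ j" and summ: "\<And>i j. summable (\<lambda>k. mpow M k $ i $ j)"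
  shows summable_trace_mpow: "summable (\<lambda>k. trace (mpow M k) / k)"
    and det_mat_1_minus_times_exp: "det (mat 1 - M) * exp (\<Sum>k. trace (mpow M k) / k) = 1"
proof -
  define c where "c k = trace (mpow M k) / real k" for k
  have tr_nonneg: "0 \<le> trace (mpow M k)" for k
    unfolding trace_def by (intro sum_nonneg mpow_nonneg nonneg)
  have tr_summ: "summable (\<lambda>k. trace (mpow M k))"
    unfolding trace_def by (intro summable_sum summ)
  \<comment> \<open>For \<open>k = 0\<close> the quotient is \<open>c 0 = 0\<close>, since division
    by zero yields zero.\<close>
  have c_le: "c k \<le> trace (mpow M k)" and c_nonneg: "0 \<le> c k" for k
    using tr_nonneg[of k] by (cases k; simp add: c_def field_simps mult_le_cancel_left1)+
  show c_summ: "summable (\<lambda>k. trace (mpow M k) / k)"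
    using summable_comparison_test'[OF tr_summ, of 0 c] c_le c_nonneg by (simp add: c_def[abs_def] tr_nonneg)
  define L where "L t = (\<Sum>k. c k * t ^ k)" for t
  define g where "g t = det (mat 1 - t *\<^sub>R M) * exp (L t)" for t
  have c_summ': "summable c" using c_summ by (simp add: c_def[abs_def])
  \<comment> \<open>Convergence is known only up to \<open>t = 1\<close>, so continuity at that
    endpoint is obtained from uniform convergence, with the summable \<open>c\<close> as
    majorant.\<close>
  have L_cont: "continuous_on {0..1} L"
  proof -
    have "uniform_limit {0..1} (\<lambda>n t. \<Sum>k<n. c k * t ^ k) L sequentially"
      unfolding L_def
    proof (rule Weierstrass_m_test)
      show "norm (c n * x ^ n) \<le> c n" if "x \<in> {0..1}" for n x
        using that c_nonneg[of n] by (simp add: abs_mult mult_left_le power_le_one)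
    qed (rule c_summ')
    then show ?thesis
      by (rule uniform_limit_theorem[rotated]) (auto intro!: always_eventually continuous_intros)
  qed
  have cont: "continuous_on {0..1} g"
    unfolding g_def det_def by (intro continuous_intros L_cont)
  have deriv: "(g has_field_derivative 0) (at t)" if t: "0 < t" "t < 1" for t
  proof -
    have summ_t: "summable (\<lambda>k. mpow (t *\<^sub>R M) k $ i $ j)" for i j
    proof (rule summable_comparison_test'[OF summ[of i j]])
      show "norm (mpow (t *\<^sub>R M) k $ i $ j) \<le> mpow M k $ i $ j" for k
        using t mpow_nonneg[OF nonneg, of k i j]
        by (simp add: mpow_scaleR abs_mult mult_left_le_one_le power_le_one)
    qed
    define R where "R = (\<chi> i j. \<Sum>k. mpow (t *\<^sub>R M) k $ i $ j)"
    have R: "(mat 1 - t *\<^sub>R M) ** R = mat 1"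
      unfolding R_def by (rule neumann_series[OF summ_t])
    have "(L has_field_derivative (\<Sum>k. diffs c k * t ^ k)) (at t)"
      unfolding L_def using t c_summ' by (intro termdiffs_strong[where K = 1]) auto
    \<comment> \<open>\<open>diffs c k\<close> is \<open>(k + 1) * c (k + 1)\<close>: the factor
      cancels the denominator and leaves the trace of \<open>M^(k+1)\<close>.\<close>
    also have "(\<Sum>k. diffs c k * t ^ k) = (\<Sum>k. t ^ k * trace (mpow M k ** M))"
      by (simp add: diffs_def c_def mpow_Suc mpow_commute mult.commute del: of_nat_Suc)
    also have "\<dots> = (\<Sum>k. trace (mpow (t *\<^sub>R M) k ** M))"
      by (simp add: mpow_scaleR scalar_matrix_assoc[symmetric] trace_scaleR)
    also have "\<dots> = (\<Sum>i\<in>UNIV. \<Sum>l\<in>UNIV. \<Sum>k. mpow (t *\<^sub>R M) k $ i $ l * M $ l $ i)"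
      unfolding trace_def matrix_matrix_mult_def
      by (simp add: suminf_sum summable_sum summable_mult2 summ_t)
    also have "\<dots> = trace (R ** M)"
      unfolding trace_def matrix_matrix_mult_def R_def
      by (simp add: suminf_mult2[symmetric] summ_t)
    finally have L: "(L has_field_derivative trace (R ** M)) (at t)" .
    show ?thesis
      unfolding g_def
      by (rule derivative_eq_intros has_derivative_det_resolvent[OF R] L refl)+ simp
  qed
  \<comment> \<open>Here \<open>0 ^ 0 = 1\<close>, so the constant term disappears only through
    \<open>c 0 = 0\<close>.\<close>
  have "c k * 0 ^ k = 0" for k
    by (cases k) (simp_all add: c_def)
  then have L0: "L 0 = 0"
    by (simp only: L_def) simp
  have "g 1 = g 0"
    by (rule DERIV_isconst_end[OF _ cont deriv]) auto
  also have "g 0 = 1"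
    by (simp add: g_def L0)
  finally show "det (mat 1 - M) * exp (\<Sum>k. trace (mpow M k) / k) = 1"
    by (simp add: g_def L_def c_def)
qed

section \<open>M-matrices, their Jacobi splitting and the permanental determinant\<close>

lemma
  assumes "invertible A"
  shows matrix_inv_right: "A ** matrix_inv A = mat 1" and matrix_inv_left: "matrix_inv A ** A = mat 1"
  using someI_ex[OF assms[unfolded invertible_def]] by (simp_all add: matrix_inv_def)

text \<open>The off-diagonal terms in entry \<open>(i, i)\<close> of \<open>A A^-1 = I\<close> are
  at most 0, so \<open>A $ i $ i\<close> times a non-negative number is at least 1.\<close>

lemma M_matrix_diag_pos:
  fixes A :: "real^'n^'n"
  assumes "nonsingular_M_matrix A"
  shows "0 < A $ i $ i"
proof -
  let ?G = "matrix_inv A"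
  have off: "A $ i $ j \<le> 0" if "i \<noteq> j" for j
    using assms that by (simp add: nonsingular_M_matrix_def)
  have G: "?G $ j $ i \<ge> 0" for j
    using assms by (simp add: nonsingular_M_matrix_def)
  have inv: "A ** ?G = mat 1"
    using assms by (auto simp: nonsingular_M_matrix_def matrix_inv_right)
  have "1 = (A ** ?G) $ i $ i" by (simp add: inv mat_def)
  also have "\<dots> = A $ i $ i * ?G $ i $ i + (\<Sum>j\<in>UNIV - {i}. A $ i $ j * ?G $ j $ i)"
    by (simp add: matrix_matrix_mult_def sum.remove[of UNIV i])
  also have "(\<Sum>j\<in>UNIV - {i}. A $ i $ j * ?G $ j $ i) \<le> 0"
    using off G by (intro sum_nonpos mult_nonpos_nonneg) auto
  finally have "0 < A $ i $ i * ?G $ i $ i" by simp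
  then show ?thesis using G[of i] by (simp add: zero_less_mult_iff)
qed

text \<open>For nonzero diagonal entries this is the iteration matrix \<open>I - D^-1 A\<close> of
  Jacobi's method, with \<open>D\<close> the diagonal of \<open>A\<close>; it is the
  \<open>C\<close> of the splitting \<open>A = D (I - C)\<close>.\<close>

definition jacobi_matrix :: "real^'n^'n \<Rightarrow> real^'n^'n" where
  "jacobi_matrix A = (\<chi> i j. if i = j then 0 else - A $ i $ j / A $ i $ i)"

lemma diag_matrix_nth: "diag_matrix d $ i $ j = (if i = j then d $ i else 0)"
  by (simp add: diag_matrix_def)

lemma diag_matrix_mult: "(diag_matrix d ** A) $ i $ j = d $ i * A $ i $ j"
  by (simp add: matrix_matrix_mult_def sum.remove[of UNIV i] diag_matrix_nth)

lemma M_matrix_eq: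
  fixes A :: "real^'n^'n"
  assumes "nonsingular_M_matrix A"
  shows "A = diag_matrix (\<chi> i. A $ i $ i) ** (mat 1 - jacobi_matrix A)"
proof -
  have "A $ i $ i \<noteq> 0" for i using M_matrix_diag_pos[OF assms, of i] by simp
  then show ?thesis
    by (auto simp: vec_eq_iff diag_matrix_mult jacobi_matrix_def mat_def)
qed

lemma jacobi_matrix_nonneg:
  assumes "nonsingular_M_matrix A"
  shows "0 \<le> jacobi_matrix A $ i $ j"
  using assms M_matrix_diag_pos[OF assms, of i]
  by (auto simp: jacobi_matrix_def nonsingular_M_matrix_def divide_nonpos_pos)

text \<open>With \<open>H = (I - C)\<inverse> \<ge> 0\<close>, the partial sums of the powers of \<open>C\<close> are \<open>(I - C ^ N) H \<le> H\<close>.\<close>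
lemma summable_mpow_jacobi_matrix:
  fixes A :: "real^'n^'n"
  assumes A: "nonsingular_M_matrix A"
  shows "summable (\<lambda>k. mpow (jacobi_matrix A) k $ i $ j)"
proof (rule summableI_nonneg_bounded)
  let ?C = "jacobi_matrix A" and ?D = "diag_matrix (\<chi> i. A $ i $ i)"
  define H where "H = matrix_inv A ** ?D"
  have C: "0 \<le> mpow ?C k $ i $ j" for k i j
    by (intro mpow_nonneg jacobi_matrix_nonneg A)
  show "0 \<le> mpow ?C k $ i $ j" for k by (rule C)
  \<comment> \<open>The product equals \<open>A^-1 D (I - C) = A^-1 A\<close>; for square matrices a
    left inverse is also a right inverse.\<close>
  have "H ** (mat 1 - ?C) = mat 1"
    using M_matrix_eq[OF A] A
    by (simp add: H_def matrix_mul_assoc[symmetric] nonsingular_M_matrix_def matrix_inv_left)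
  then have H: "(mat 1 - ?C) ** H = mat 1" by (simp add: matrix_left_right_inverse)
  have H_nonneg: "0 \<le> H $ i $ j" for i j
    unfolding H_def matrix_matrix_mult_def diag_matrix_def
    using A M_matrix_diag_pos[OF A] by (auto intro!: sum_nonneg mult_nonneg_nonneg simp: nonsingular_M_matrix_def less_imp_le)
  show "(\<Sum>k<N. mpow ?C k $ i $ j) \<le> H $ i $ j" for N
  proof -
    have "(\<Sum>k<N. mpow ?C k) = H - mpow ?C N ** H"
    proof (induction N)
      case (Suc N)
      \<comment> \<open>Inserting \<open>I = (I - C) H\<close> after \<open>C^N\<close> makes the
        partial sums telescope.\<close>
      have "mpow ?C N = mpow ?C N ** ((mat 1 - ?C) ** H)" by (simp add: H)
      also have "\<dots> = mpow ?C N ** H - mpow ?C (Suc N) ** H"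
        by (simp add: matrix_mul_assoc matrix_diff_ldistrib matrix_diff_rdistrib mpow_commute mpow_Suc)
      finally have "(\<Sum>k<Suc N. mpow ?C k) = (H - mpow ?C N ** H) + (mpow ?C N ** H - mpow ?C (Suc N) ** H)"
        using Suc by (metis sum.lessThan_Suc)
      then show ?case by simp
    qed simp
    then have "(\<Sum>k<N. mpow ?C k $ i $ j) = H $ i $ j - (mpow ?C N ** H) $ i $ j"
      by (metis sum_component vector_minus_component)
    also have "\<dots> \<le> H $ i $ j"
      using C H_nonneg by (auto simp: matrix_matrix_mult_def intro!: sum_nonneg)
    finally show ?thesis .
  qed
qed

text \<open>For \<open>C \<ge> 0\<close> with summable powers and \<open>z\<close> in the unit cube
  this is \<open>- log det (I - Z C)\<close>. The term at \<open>k = 0\<close> is zero because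
  division by zero yields zero.\<close>

definition log_det_series :: "real^'n^'n \<Rightarrow> real^'n \<Rightarrow> real" where
  "log_det_series C z = (\<Sum>k. trace (mpow (diag_matrix z ** C) k) / k)"

text \<open>Entrywise \<open>0 \<le> Z C \<le> C\<close> on the unit cube, so the powers of
  \<open>Z C\<close> are dominated by those of \<open>C\<close> and the identity for
  \<open>det (I - M)\<close> applies with \<open>M = Z C\<close>.\<close>

lemma
  fixes C :: "real^'n^'n"
  assumes nonneg: "\<And>i j. 0 \<le> C $ i $ j" and summ: "\<And>i j. summable (\<lambda>k. mpow C k $ i $ j)"
    and z: "\<And>i. 0 \<le> z $ i" "\<And>i. z $ i \<le> 1"
  shows summable_log_det_series: "summable (\<lambda>k. trace (mpow (diag_matrix z ** C) k) / k)"
    and det_diag_eq_exp: "det (mat 1 - diag_matrix z ** C) = exp (- log_det_series C z)"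
proof -
  let ?M = "diag_matrix z ** C"
  have M: "0 \<le> ?M $ i $ j" for i j
    using z nonneg by (simp add: diag_matrix_mult)
  have "?M $ i $ j \<le> C $ i $ j" for i j
    using z nonneg by (simp add: diag_matrix_mult mult_left_le_one_le)
  then have "summable (\<lambda>k. mpow ?M k $ i $ j)" for i j
    using mpow_mono[OF M, where N = C] mpow_nonneg[OF M] summ
    by (intro summable_comparison_test'[OF summ[of i j]]) auto
  note * = M this
  show "summable (\<lambda>k. trace (mpow ?M k) / k)"
    by (rule summable_trace_mpow[OF *])
  show "det (mat 1 - ?M) = exp (- log_det_series C z)"
    using det_mat_1_minus_times_exp[OF *]
    by (simp add: log_det_series_def exp_minus field_simps)
qed

lemma det_diag_matrix: "det (diag_matrix d) = (\<Prod>i\<in>UNIV. d $ i)"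
  by (subst det_diagonal) (auto simp: diag_matrix_def)

text \<open>With \<open>D\<close> the diagonal of \<open>A = D (I - C)\<close>, \<open>T = D\<inverse> S\<close> and \<open>Z = (I + T)\<inverse>\<close>, one has
  \<open>(I - C) (I + K S) = (I + T) (I - Z C)\<close>.\<close>
lemma det_permanental:
  fixes K A :: "real^'n^'n"
  assumes "invertible K" "A = matrix_inv K" and A: "nonsingular_M_matrix A"
    and s: "\<And>i. 0 \<le> s $ i"
    and z_def: "z = (\<chi> i. 1 / (1 + s $ i / A $ i $ i))"
  shows "det (mat 1 + K ** diag_matrix s)
    = exp (log_det_series (jacobi_matrix A) (\<chi> i. 1) - log_det_series (jacobi_matrix A) z) / (\<Prod>i\<in>UNIV. z $ i)"
proof -
  let ?C = "jacobi_matrix A" and ?D = "diag_matrix (\<chi> i. A $ i $ i)" and ?T = "diag_matrix (\<chi> i. s $ i / A $ i $ i)"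
  let ?Z = "diag_matrix z"
  have pos: "0 < A $ i $ i" for i by (rule M_matrix_diag_pos[OF A])
  have t: "0 \<le> s $ i / A $ i $ i" for i using s pos[of i] by simp
  have z: "0 < z $ i" "z $ i \<le> 1" for i using t[of i] by (simp_all add: z_def)
  have AK: "A ** K = mat 1" using assms by (simp add: matrix_inv_left)
  have D: "?D ** B = ?D ** B' \<Longrightarrow> B = B'" for B B' :: "real^'n^'n"
    using pos by (simp add: vec_eq_iff diag_matrix_mult less_imp_neq[THEN not_sym])
  have "?D ** ((mat 1 - ?C) ** (mat 1 + K ** diag_matrix s)) = A ** (mat 1 + K ** diag_matrix s)"
    using M_matrix_eq[OF A] by (simp add: matrix_mul_assoc)
  also have "\<dots> = A + diag_matrix s"
    by (simp add: matrix_add_ldistrib matrix_mul_assoc AK)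
  also have "\<dots> = ?D ** (diag_matrix (\<chi> i. 1 / z $ i) ** (mat 1 - ?Z ** ?C))"
  proof -
    have nz: "A $ i $ i \<noteq> 0" "z $ i \<noteq> 0" for i using pos[of i] z(1)[of i] by simp_all
    have "A $ i $ i / z $ i = A $ i $ i + s $ i" for i
      using nz(1)[of i] by (simp add: z_def field_simps)
    then show ?thesis
      by (simp add: vec_eq_iff diag_matrix_mult jacobi_matrix_def mat_def diag_matrix_nth nz)
  qed
  finally have "(mat 1 - ?C) ** (mat 1 + K ** diag_matrix s) = diag_matrix (\<chi> i. 1 / z $ i) ** (mat 1 - ?Z ** ?C)"
    by (rule D)
  then have "det (mat 1 - ?C) * det (mat 1 + K ** diag_matrix s) = (\<Prod>i\<in>UNIV. 1 / z $ i) * det (mat 1 - ?Z ** ?C)"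
    by (metis (no_types, lifting) det_diag_matrix det_mul prod.cong vec_lambda_beta)
  moreover have "det (mat 1 - ?Z ** ?C) = exp (- log_det_series ?C z)"
    using z by (intro det_diag_eq_exp jacobi_matrix_nonneg summable_mpow_jacobi_matrix A) (auto intro: less_imp_le)
  \<comment> \<open>Taking \<open>z = 1\<close> expresses \<open>det (I - C)\<close> itself as an
    exponential, so it can be divided out.\<close>
  moreover have "det (mat 1 - diag_matrix (\<chi> i. 1) ** ?C) = exp (- log_det_series ?C (\<chi> i. 1))"
    by (intro det_diag_eq_exp jacobi_matrix_nonneg summable_mpow_jacobi_matrix A) auto
  moreover have "diag_matrix (\<chi> i. 1) ** ?C = ?C" by (simp add: vec_eq_iff diag_matrix_mult)
  ultimately have e: "exp (- log_det_series ?C (\<chi> i. 1)) * det (mat 1 + K ** diag_matrix s)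
      = exp (- log_det_series ?C z) / (\<Prod>i\<in>UNIV. z $ i)"
    by (simp add: prod_dividef)
  have "det (mat 1 + K ** diag_matrix s)
      = exp (log_det_series ?C (\<chi> i. 1)) * (exp (- log_det_series ?C (\<chi> i. 1)) * det (mat 1 + K ** diag_matrix s))"
    by (simp add: exp_minus)
  then show ?thesis unfolding e by (simp add: exp_diff exp_minus divide_inverse)
qed

section \<open>Power series with non-negative coefficients\<close>

text \<open>The monomials are enumerated with possible repetitions, which makes countable sums and products
  a matter of reindexing by pairs.\<close>
definition nonneg_power_series :: "(real^'n \<Rightarrow> ennreal) \<Rightarrow> bool" where
  "nonneg_power_series f \<longleftrightarrow> (\<exists>(w :: nat \<Rightarrow> ennreal) (m :: nat \<Rightarrow> 'n \<Rightarrow> nat).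
     \<forall>z. (\<forall>i. 0 \<le> z $ i \<and> z $ i \<le> 1) \<longrightarrow> f z = (\<Sum>j. w j * (\<Prod>i\<in>UNIV. ennreal (z $ i) ^ m j i)))"

lemma nonneg_power_series_cong:
  assumes "nonneg_power_series f" "\<And>z. (\<And>i. 0 \<le> z $ i) \<Longrightarrow> (\<And>i. z $ i \<le> 1) \<Longrightarrow> f z = g z"
  shows "nonneg_power_series g"
proof -
  obtain w m where "\<And>z. (\<forall>i. 0 \<le> z $ i \<and> z $ i \<le> 1) \<Longrightarrow>
      f z = (\<Sum>j. w j * (\<Prod>i\<in>UNIV. ennreal (z $ i) ^ m j i))"
    using assms(1) unfolding nonneg_power_series_def by auto
  with assms(2) show ?thesis
    unfolding nonneg_power_series_def by (intro exI[of _ w] exI[of _ m]) simp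
qed

lemma nonneg_power_series_suminf:
  fixes f :: "nat \<Rightarrow> real^'n \<Rightarrow> ennreal"
  assumes "\<And>l. nonneg_power_series (f l)"
  shows "nonneg_power_series (\<lambda>z. \<Sum>l. f l z)"
proof -
  let ?cube = "\<lambda>z :: real^'n. \<forall>i. 0 \<le> z $ i \<and> z $ i \<le> 1"
  let ?g = "\<lambda>w m z. \<Sum>j. w j * (\<Prod>i\<in>UNIV. ennreal (z $ i) ^ m j i)"
  have "\<forall>l. \<exists>w m. \<forall>z. ?cube z \<longrightarrow> f l z = ?g w m z"
    using assms unfolding nonneg_power_series_def by simp
  from choice[OF this] obtain w where "\<forall>l. \<exists>m. \<forall>z. ?cube z \<longrightarrow> f l z = ?g (w l) m z"
    by (rule exE)
  from choice[OF this] obtain m where wm: "\<forall>l z. ?cube z \<longrightarrow> f l z = ?g (w l) (m l) z"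
    by (rule exE)
  show ?thesis
    unfolding nonneg_power_series_def
  proof (intro exI allI impI)
    fix z :: "real^'n" assume "?cube z"
    then have "(\<Sum>n. case_prod (\<lambda>l j. w l j * (\<Prod>i\<in>UNIV. ennreal (z $ i) ^ m l j i)) (prod_decode n)) = (\<Sum>l. f l z)"
      by (intro suminf_ennreal_2dimen) (simp add: wm)
    then show "(\<Sum>l. f l z) = (\<Sum>n. case_prod w (prod_decode n) *
        (\<Prod>i\<in>UNIV. ennreal (z $ i) ^ case_prod m (prod_decode n) i))"
      by (simp add: case_prod_beta)
  qed
qed

lemma nonneg_power_series_monom:
  "nonneg_power_series (\<lambda>z. c * (\<Prod>i\<in>UNIV. ennreal (z $ i) ^ k i))"
proof -
  have "(\<Sum>j. (if j = 0 then c else 0) * y) = c * y" for y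
    by (subst suminf_finite[of "{0}"]) auto
  then show ?thesis
    unfolding nonneg_power_series_def
    by (intro exI[of _ "\<lambda>j. if j = 0 then c else 0"] exI[of _ "\<lambda>_. k"]) simp
qed

lemma nonneg_power_series_const: "nonneg_power_series (\<lambda>_. c)"
  using nonneg_power_series_monom[of c "\<lambda>_. 0"] by simp

lemma nonneg_power_series_coordinate: "nonneg_power_series (\<lambda>z. ennreal (z $ i))"
proof -
  have "(\<Prod>j\<in>UNIV. ennreal (z $ j) ^ (if j = i then 1 else 0)) = ennreal (z $ i)" for z :: "real^'a"
    by (simp add: if_distrib cong: if_cong)
  then show ?thesis
    using nonneg_power_series_monom[of 1 "\<lambda>j. if j = i then 1 else 0"] by simp
qed

lemma nonneg_power_series_monom_mult:
  assumes "nonneg_power_series f"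
  shows "nonneg_power_series (\<lambda>z. c * (\<Prod>i\<in>UNIV. ennreal (z $ i) ^ k i) * f z)"
proof -
  obtain w m where wm: "\<And>z. (\<forall>i. 0 \<le> z $ i \<and> z $ i \<le> 1) \<Longrightarrow>
      f z = (\<Sum>j. w j * (\<Prod>i\<in>UNIV. ennreal (z $ i) ^ m j i))"
    using assms unfolding nonneg_power_series_def by blast
  show ?thesis
    unfolding nonneg_power_series_def
  proof (intro exI allI impI)
    fix z :: "real^'a" assume "\<forall>i. 0 \<le> z $ i \<and> z $ i \<le> 1"
    then have "c * (\<Prod>i\<in>UNIV. ennreal (z $ i) ^ k i) * f z =
       (\<Sum>j. c * (\<Prod>i\<in>UNIV. ennreal (z $ i) ^ k i) * (w j * (\<Prod>i\<in>UNIV. ennreal (z $ i) ^ m j i)))"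
      by (simp add: wm)
    also have "\<dots> = (\<Sum>j. (c * w j) * (\<Prod>i\<in>UNIV. ennreal (z $ i) ^ (k i + m j i)))"
      unfolding power_add prod.distrib by (intro suminf_cong) (simp only: mult_ac)
    finally show "c * (\<Prod>i\<in>UNIV. ennreal (z $ i) ^ k i) * f z =
       (\<Sum>j. (c * w j) * (\<Prod>i\<in>UNIV. ennreal (z $ i) ^ (k i + m j i)))" .
  qed
qed

text \<open>Expanding only \<open>f\<close> writes the product as a countable sum of monomials times
  \<open>g\<close>, to which closure under \<open>suminf\<close> applies; this avoids a Cauchy
  product.\<close>

lemma nonneg_power_series_mult:
  assumes "nonneg_power_series f" "nonneg_power_series g"
  shows "nonneg_power_series (\<lambda>z. f z * g z)"
proof -
  obtain w m where wm: "\<And>z. (\<forall>i. 0 \<le> z $ i \<and> z $ i \<le> 1) \<Longrightarrow>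
      f z = (\<Sum>j. w j * (\<Prod>i\<in>UNIV. ennreal (z $ i) ^ m j i))"
    using assms(1) unfolding nonneg_power_series_def by blast
  have "nonneg_power_series (\<lambda>z. \<Sum>j. w j * (\<Prod>i\<in>UNIV. ennreal (z $ i) ^ m j i) * g z)"
    by (intro nonneg_power_series_suminf nonneg_power_series_monom_mult assms)
  then show ?thesis
    by (rule nonneg_power_series_cong) (simp add: wm ennreal_suminf_multc)
qed

lemma nonneg_power_series_sum:
  assumes "\<And>x. x \<in> A \<Longrightarrow> nonneg_power_series (f x)"
  shows "nonneg_power_series (\<lambda>z. \<Sum>x\<in>A. f x z)"
proof -
  have add: "nonneg_power_series (\<lambda>z. g z + h z)"
    if "nonneg_power_series g" "nonneg_power_series h" for g h :: "real^'b \<Rightarrow> ennreal"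
  proof -
    \<comment> \<open>A sum of two functions is a countable sum padded with zeros.\<close>
    let ?f = "\<lambda>l z. if l = 0 then g z else if l = Suc 0 then h z else 0"
    have "nonneg_power_series (?f l)" for l :: nat
      using that by (cases "l = 0"; cases "l = Suc 0") (simp_all add: nonneg_power_series_const)
    from nonneg_power_series_suminf[of ?f, OF this] show ?thesis
      by (rule nonneg_power_series_cong)
         (subst suminf_finite[of "{0, Suc 0}"], auto)
  qed
  from assms show ?thesis
    by (induction A rule: infinite_finite_induct) (auto intro: add nonneg_power_series_const)
qed

lemma nonneg_power_series_power:
  "nonneg_power_series f \<Longrightarrow> nonneg_power_series (\<lambda>z. f z ^ k)"
  by (induction k) (auto intro: nonneg_power_series_const nonneg_power_series_mult)

text \<open>The coefficients \<open>1 / k!\<close> of the exponential series are non-negative. Since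
  \<open>ennreal\<close> truncates negative numbers to 0, non-negativity of \<open>f\<close> on the
  cube ensures that \<open>ennreal (f z) ^ k\<close> represents \<open>f z ^ k\<close>.\<close>

lemma nonneg_power_series_exp:
  fixes f :: "real^'n \<Rightarrow> real"
  assumes "nonneg_power_series (\<lambda>z. ennreal (f z))"
    and nonneg: "\<And>z. (\<And>i. 0 \<le> z $ i) \<Longrightarrow> (\<And>i. z $ i \<le> 1) \<Longrightarrow> 0 \<le> f z"
  shows "nonneg_power_series (\<lambda>z. ennreal (exp (f z)))"
proof -
  have "nonneg_power_series (\<lambda>z. \<Sum>k. ennreal (1 / fact k) * ennreal (f z) ^ k)"
    by (intro nonneg_power_series_suminf nonneg_power_series_mult nonneg_power_series_const
        nonneg_power_series_power assms)
  then show ?thesis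
  proof (rule nonneg_power_series_cong)
    fix z :: "real^'n" assume "\<And>i. 0 \<le> z $ i" "\<And>i. z $ i \<le> 1"
    then have f: "0 \<le> f z" by (rule nonneg)
    have "(\<Sum>k. ennreal (1 / fact k) * ennreal (f z) ^ k) = (\<Sum>k. ennreal (f z ^ k /\<^sub>R fact k))"
      using f by (intro suminf_cong) (simp add: ennreal_power ennreal_mult[symmetric] field_simps)
    also have "\<dots> = ennreal (exp (f z))"
      using f exp_converges[of "f z"] by (intro suminf_ennreal_eq) auto
    finally show "(\<Sum>k. ennreal (1 / fact k) * ennreal (f z) ^ k) = ennreal (exp (f z))" .
  qed
qed

section \<open>Expansion of matrix powers and of the logarithm of the determinant\<close>

lemma nonneg_power_series_mpow:
  fixes C :: "real^'n^'n"
  assumes "\<And>i j. 0 \<le> C $ i $ j"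
  shows "nonneg_power_series (\<lambda>z. ennreal (mpow (diag_matrix z ** C) k $ i $ j))"
proof (induction k arbitrary: i)
  case 0
  show ?case by (simp add: nonneg_power_series_const)
next
  case (Suc k)
  have "nonneg_power_series (\<lambda>z. \<Sum>l\<in>UNIV. ennreal (z $ i) * ennreal (C $ i $ l) * ennreal (mpow (diag_matrix z ** C) k $ l $ j))"
    by (intro nonneg_power_series_sum nonneg_power_series_mult nonneg_power_series_const
        nonneg_power_series_coordinate Suc)
  then show ?case
  proof (rule nonneg_power_series_cong)
    fix z :: "real^'n" assume z: "\<And>i. 0 \<le> z $ i"
    have "0 \<le> (diag_matrix z ** C) $ i $ j" for i j
      using z assms by (simp add: diag_matrix_mult)
    then have "0 \<le> mpow (diag_matrix z ** C) k $ i $ j" for i j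
      by (rule mpow_nonneg)
    moreover have "mpow (diag_matrix z ** C) (Suc k) $ i $ j
        = (\<Sum>l\<in>UNIV. z $ i * C $ i $ l * mpow (diag_matrix z ** C) k $ l $ j)"
      by (subst mpow_Suc, subst matrix_matrix_mult_def) (simp add: diag_matrix_mult)
    ultimately show "(\<Sum>l\<in>UNIV. ennreal (z $ i) * ennreal (C $ i $ l) * ennreal (mpow (diag_matrix z ** C) k $ l $ j))
        = ennreal (mpow (diag_matrix z ** C) (Suc k) $ i $ j)"
      using z assms by (simp add: ennreal_mult[symmetric] sum_ennreal)
  qed
qed

text \<open>The traces of the powers of \<open>Z C\<close> are polynomials in \<open>z\<close> with
  non-negative coefficients, and the weights \<open>1 / k\<close> preserve this sign.\<close>

lemma
  fixes C :: "real^'n^'n"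
  assumes nonneg: "\<And>i j. 0 \<le> C $ i $ j" and summ: "\<And>i j. summable (\<lambda>k. mpow C k $ i $ j)"
  shows nonneg_power_series_log_det: "nonneg_power_series (\<lambda>z. ennreal (log_det_series C z))"
    and log_det_series_nonneg:
      "\<And>z. (\<And>i. 0 \<le> z $ i) \<Longrightarrow> (\<And>i. z $ i \<le> 1) \<Longrightarrow> 0 \<le> log_det_series C z"
proof -
  have entry: "0 \<le> mpow (diag_matrix z ** C) k $ i $ i" if z: "\<And>i. 0 \<le> z $ i" for z :: "real^'n" and k i
    using z nonneg by (intro mpow_nonneg) (simp add: diag_matrix_mult)
  then have term_nonneg: "0 \<le> trace (mpow (diag_matrix z ** C) k) / k" if z: "\<And>i. 0 \<le> z $ i" for z :: "real^'n" and k
    using z by (auto simp: trace_def intro!: divide_nonneg_nonneg sum_nonneg)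
  show "0 \<le> log_det_series C z" if "\<And>i. 0 \<le> z $ i" "\<And>i. z $ i \<le> 1" for z
    unfolding log_det_series_def
    by (intro suminf_nonneg summable_log_det_series nonneg summ that term_nonneg)
  have "nonneg_power_series (\<lambda>z. \<Sum>k. ennreal (1 / real k) * (\<Sum>i\<in>UNIV. ennreal (mpow (diag_matrix z ** C) k $ i $ i)))"
    by (intro nonneg_power_series_suminf nonneg_power_series_mult nonneg_power_series_const
        nonneg_power_series_sum nonneg_power_series_mpow nonneg)
  then show "nonneg_power_series (\<lambda>z. ennreal (log_det_series C z))"
  proof (rule nonneg_power_series_cong)
    fix z :: "real^'n" assume z: "\<And>i. 0 \<le> z $ i" "\<And>i. z $ i \<le> 1"
    have "(\<Sum>k. ennreal (1 / real k) * (\<Sum>i\<in>UNIV. ennreal (mpow (diag_matrix z ** C) k $ i $ i)))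
        = (\<Sum>k. ennreal (trace (mpow (diag_matrix z ** C) k) / k))"
      using entry[OF z(1)]
      by (intro suminf_cong) (simp add: sum_ennreal trace_def ennreal_mult[symmetric] sum_nonneg)
    also have "\<dots> = ennreal (log_det_series C z)"
      unfolding log_det_series_def
      by (intro suminf_ennreal2 term_nonneg summable_log_det_series nonneg summ z)
    finally show "(\<Sum>k. ennreal (1 / real k) * (\<Sum>i\<in>UNIV. ennreal (mpow (diag_matrix z ** C) k $ i $ i)))
        = ennreal (log_det_series C z)" .
  qed
qed

text \<open>The value at \<open>z = 1\<close> is the sum of the coefficients, so these form a
  probability mass function. On the unit cube \<open>f\<close> is then the probability generating
  function of the random multi-index \<open>m j\<close>, with \<open>j\<close> drawn from
  \<open>p\<close>.\<close>

lemma nonneg_power_series_pmf: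
  fixes f :: "real^'n \<Rightarrow> ennreal"
  assumes "nonneg_power_series f" and one: "f (\<chi> i. 1) = 1"
  obtains p :: "nat pmf" and m :: "nat \<Rightarrow> 'n \<Rightarrow> nat"
  where "\<And>z. (\<And>i. 0 \<le> z $ i) \<Longrightarrow> (\<And>i. z $ i \<le> 1) \<Longrightarrow>
     (\<integral>\<^sup>+j. (\<Prod>i\<in>UNIV. ennreal (z $ i) ^ m j i) \<partial>measure_pmf p) = f z"
proof -
  obtain w :: "nat \<Rightarrow> ennreal" and m :: "nat \<Rightarrow> 'n \<Rightarrow> nat"
    where wm: "\<And>z. (\<forall>i. 0 \<le> z $ i \<and> z $ i \<le> 1) \<Longrightarrow>
      f z = (\<Sum>j. w j * (\<Prod>i\<in>UNIV. ennreal (z $ i) ^ m j i))"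
    using assms(1) unfolding nonneg_power_series_def by blast
  have sum_w: "(\<Sum>j. w j) = 1" using wm[of "\<chi> i. 1"] one by simp
  \<comment> \<open>\<open>embed_pmf\<close> expects real weights; each one is finite, being bounded
    by the total 1.\<close>
  have w_fin: "w j < \<top>" for j
  proof -
    have "w j \<le> (\<Sum>j. w j)" using sum_le_suminf[of w "{j}"] by simp
    then show ?thesis unfolding sum_w by (metis ennreal_one_less_top le_less_trans)
  qed
  then have w: "ennreal (enn2real (w j)) = w j" for j by simp
  have tot: "(\<integral>\<^sup>+j. ennreal (enn2real (w j)) \<partial>count_space UNIV) = 1"
    unfolding w by (simp add: nn_integral_count_space_nat sum_w)
  define p where "p = embed_pmf (\<lambda>j. enn2real (w j))"
  have p: "ennreal (pmf p j) = w j" for j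
    unfolding p_def by (subst pmf_embed_pmf) (use tot w in simp_all)
  show ?thesis
  proof (rule that)
    fix z :: "real^'n" assume "\<And>i. 0 \<le> z $ i" "\<And>i. z $ i \<le> 1"
    then have "f z = (\<Sum>j. w j * (\<Prod>i\<in>UNIV. ennreal (z $ i) ^ m j i))" by (simp add: wm)
    then show "(\<integral>\<^sup>+j. (\<Prod>i\<in>UNIV. ennreal (z $ i) ^ m j i) \<partial>measure_pmf p) = f z"
      by (simp add: nn_integral_measure_pmf nn_integral_count_space_nat p)
  qed
qed

section \<open>Uniqueness of multivariate Laplace transforms\<close>

lemma borel_measurable_vec_lambda [measurable (raw)]:
  assumes "\<And>i. (\<lambda>x. f x i) \<in> borel_measurable M"
  shows "(\<lambda>x. \<chi> i. f x i :: real^'n) \<in> borel_measurable M"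
  using assms by (subst borel_measurable_euclidean_space) (auto simp: Basis_vec_def inner_axis)

text \<open>The polynomial functions. Generating them from monomials by sums alone lets an identity
  that is additive in the function be proved by checking monomials.\<close>

inductive monomial_span :: "(real^'n \<Rightarrow> real) \<Rightarrow> bool" where
  monomial: "monomial_span (\<lambda>y. c * (\<Prod>i\<in>UNIV. y $ i ^ m i))"
| add: "monomial_span f \<Longrightarrow> monomial_span g \<Longrightarrow> monomial_span (\<lambda>y. f y + g y)"

lemma monomial_span_monomial_mult:
  "monomial_span f \<Longrightarrow> monomial_span (\<lambda>y. (c * (\<Prod>i\<in>UNIV. y $ i ^ m i)) * f y)"
proof (induction rule: monomial_span.induct)
  case (monomial d k)
  show ?case
    using monomial_span.monomial[of "c * d" "\<lambda>i. m i + k i"]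
    by (simp add: power_add prod.distrib mult_ac)
next
  case (add f g)
  from monomial_span.add[OF add.IH] show ?case by (simp add: distrib_left)
qed

lemma monomial_span_mult:
  "monomial_span f \<Longrightarrow> monomial_span g \<Longrightarrow> monomial_span (\<lambda>y. f y * g y)"
proof (induction rule: monomial_span.induct)
  case (monomial c m)
  then show ?case by (intro monomial_span_monomial_mult)
next
  case (add f f')
  from monomial_span.add[OF add.IH] add.prems show ?case by (simp add: distrib_right)
qed

lemma continuous_on_monomial_span: "monomial_span f \<Longrightarrow> continuous_on S f"
  by (induction rule: monomial_span.induct) (intro continuous_intros | assumption)+

text \<open>Stone-Weierstrass: the polynomials contain the constants, and the coordinate functions
  separate points.\<close>

lemma monomial_span_dense:
  fixes f :: "real^'n \<Rightarrow> real"
  assumes "compact S" "continuous_on S f" "0 < e"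
  obtains g where "monomial_span g" "\<And>y. y \<in> S \<Longrightarrow> \<bar>f y - g y\<bar> < e"
proof -
  have const: "monomial_span (\<lambda>y :: real^'n. c)" for c
    using monomial[of c "\<lambda>_. 0"] by simp
  have sep: "\<exists>f. monomial_span f \<and> f x \<noteq> f y" if "x \<noteq> y" for x y :: "real^'n"
  proof -
    from that obtain i where i: "x $ i \<noteq> y $ i" by (auto simp: vec_eq_iff)
    have "(\<Prod>j\<in>UNIV. z $ j ^ (if j = i then 1 else 0)) = z $ i" for z :: "real^'n"
      by (simp add: if_distrib cong: if_cong)
    then show ?thesis
      using monomial[of 1 "\<lambda>j. if j = i then 1 else 0"] i by (intro exI[of _ "\<lambda>z. z $ i"]) simp
  qed
  have "\<exists>g. monomial_span g \<and> (\<forall>y\<in>S. \<bar>f y - g y\<bar> < e)"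
    by (rule Stone_Weierstrass_HOL[where P = monomial_span and S = S])
       (use assms const sep in \<open>auto intro: continuous_on_monomial_span monomial_span.add monomial_span_mult\<close>)
  with that show ?thesis by blast
qed

text \<open>Maps the orthant into a compact cube and turns the Laplace kernel at integer points into
  monomials, so that the Stone-Weierstrass theorem applies.\<close>
definition exp_neg :: "real^'n \<Rightarrow> real^'n" where
  "exp_neg x = (\<chi> i. exp (- x $ i))"

lemma measurable_exp_neg [measurable]: "exp_neg \<in> borel_measurable borel"
  unfolding exp_neg_def by measurable

lemma exp_neg_mem_cbox: "(\<And>i. 0 \<le> x $ i) \<Longrightarrow> exp_neg x \<in> cbox 0 (\<chi> i. 1)"
  by (simp add: exp_neg_def mem_box_cart)

text \<open>For almost every \<open>x\<close> the point \<open>exp_neg x\<close> lies in the unit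
  cube, where the continuous \<open>g\<close> is bounded.\<close>

lemma integrable_exp_neg_comp:
  fixes g :: "real^'n \<Rightarrow> real"
  assumes "prob_space \<mu>" and sets [measurable_cong]: "sets \<mu> = sets borel"
    and nonneg: "AE x in \<mu>. \<forall>i. 0 \<le> x $ i"
    and g: "continuous_on UNIV g"
  shows "integrable \<mu> (\<lambda>x. g (exp_neg x))"
proof -
  interpret prob_space \<mu> by fact
  have [measurable]: "g \<in> borel_measurable borel" by (intro borel_measurable_continuous_onI g)
  have "bounded (g ` cbox 0 (\<chi> i. 1))"
    by (intro compact_imp_bounded compact_continuous_image compact_cbox continuous_on_subset[OF g]) simp
  then obtain B where B: "\<And>y. y \<in> cbox 0 (\<chi> i. 1) \<Longrightarrow> norm (g y) \<le> B"
    by (auto simp: bounded_iff)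
  show ?thesis
  proof (rule integrable_const_bound)
    show "AE x in \<mu>. norm (g (exp_neg x)) \<le> B"
      using nonneg by eventually_elim (intro B exp_neg_mem_cbox, blast)
  qed measurable
qed

text \<open>The indicator of a nonempty closed set is the pointwise limit of the functions
  \<open>max 0 (1 - n * infdist x F)\<close>, so the measures agree on closed sets by dominated
  convergence. These sets form an intersection-stable generator of the Borel sets.\<close>

lemma measure_eqI_integral_continuous:
  fixes \<mu> \<nu> :: "'a::{metric_space, second_countable_topology} measure"
  assumes "prob_space \<mu>" "prob_space \<nu>"
    and sets_mu [measurable_cong]: "sets \<mu> = sets borel" and sets_nu [measurable_cong]: "sets \<nu> = sets borel"
    and eq: "\<And>f :: 'a \<Rightarrow> real. continuous_on UNIV f \<Longrightarrow> (\<And>x. 0 \<le> f x \<and> f x \<le> 1) \<Longrightarrow>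
      (\<integral>x. f x \<partial>\<mu>) = (\<integral>x. f x \<partial>\<nu>)"
  shows "\<mu> = \<nu>"
proof -
  interpret mu: prob_space \<mu> by fact
  interpret nu: prob_space \<nu> by fact
  have closed_eq: "measure \<mu> F = measure \<nu> F" if F: "closed F" for F
  \<comment> \<open>The empty set is treated separately because \<open>infdist\<close> to it is 0 by
    convention, which would make every \<open>h n\<close> equal to 1.\<close>
  proof (cases "F = {}")
    case False
    define h where "h n x = max 0 (1 - real n * infdist x F)" for n x
    have h_cont: "continuous_on UNIV (h n)" for n
      unfolding h_def by (intro continuous_intros)
    have h_bd: "0 \<le> h n x \<and> h n x \<le> 1" for n x
      by (simp add: h_def infdist_nonneg)
    have h_lim: "(\<lambda>n. h n x) \<longlonglongrightarrow> indicator F x" for x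
    proof (cases "x \<in> F")
      case True
      then show ?thesis by (simp add: h_def)
    next
      case x: False
      then have pos: "0 < infdist x F"
        using F False by (metis in_closed_iff_infdist_zero infdist_nonneg less_eq_real_def)
      obtain N where N: "1 < real N * infdist x F" using reals_Archimedean3[OF pos] by auto
      have "h n x = 0" if "n \<ge> N" for n
      proof -
        have "1 < real n * infdist x F"
          using N that pos by (smt (verit) mult_right_mono of_nat_le_iff)
        then show ?thesis by (simp add: h_def)
      qed
      then have "eventually (\<lambda>n. h n x = 0) sequentially" by (auto simp: eventually_sequentially)
      then show ?thesis using x by (simp add: tendsto_eventually)
    qed
    have [measurable]: "h n \<in> borel_measurable borel" for n
      by (intro borel_measurable_continuous_onI h_cont)
    have [measurable]: "F \<in> sets borel" using F by auto
    have lim: "(\<lambda>n. \<integral>x. h n x \<partial>M) \<longlonglongrightarrow> measure M F"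
      if "prob_space M" and [measurable_cong]: "sets M = sets borel" for M
    proof -
      interpret prob_space M by fact
      have "(\<lambda>n. \<integral>x. h n x \<partial>M) \<longlonglongrightarrow> (\<integral>x. indicator F x \<partial>M)"
        by (rule integral_dominated_convergence[where w = "\<lambda>_. 1"]) (use h_bd h_lim in \<open>auto simp: abs_le_iff\<close>)
      moreover have "F \<inter> space M = F" using sets_eq_imp_space_eq[OF that(2)] by simp
      ultimately show ?thesis by (simp add: Bochner_Integration.integral_indicator)
    qed
    have "(\<lambda>n. \<integral>x. h n x \<partial>\<mu>) = (\<lambda>n. \<integral>x. h n x \<partial>\<nu>)"
      using h_cont h_bd by (intro ext eq)
    then show ?thesis
      using lim[OF mu.prob_space_axioms sets_mu] lim[OF nu.prob_space_axioms sets_nu]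
      by (metis LIMSEQ_unique)
  qed simp
  show ?thesis
  proof (rule measure_eqI_generator_eq[where E = "{F. closed F}" and A = "\<lambda>_. UNIV" and \<Omega> = UNIV])
    show "sets \<mu> = sigma_sets UNIV {F. closed F}" "sets \<nu> = sigma_sets UNIV {F. closed F}"
      by (simp_all add: sets_mu sets_nu borel_eq_closed)
    show "emeasure \<mu> F = emeasure \<nu> F" if "F \<in> {F. closed F}" for F
      using closed_eq that by (simp add: mu.emeasure_eq_measure nu.emeasure_eq_measure)
  qed (auto simp: Int_stable_def mu.emeasure_eq_measure)
qed

text \<open>Under \<open>exp_neg\<close> the transforms at integer points become the moments of a
  law on the unit cube. Polynomial approximation extends their equality to all continuous functions,
  which determines the image law; finally \<open>exp_neg\<close> is undone.\<close>

lemma measure_eqI_laplace: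
  fixes \<mu> \<nu> :: "(real^'n) measure"
  assumes mu: "prob_space \<mu>" and nu: "prob_space \<nu>"
    and sets_mu [measurable_cong]: "sets \<mu> = sets borel" and sets_nu [measurable_cong]: "sets \<nu> = sets borel"
    and pos_mu: "AE x in \<mu>. \<forall>i. 0 \<le> x $ i" and pos_nu: "AE x in \<nu>. \<forall>i. 0 \<le> x $ i"
    and eq: "\<And>s. (\<And>i. 0 \<le> s $ i) \<Longrightarrow>
      (\<integral>x. exp (- (\<Sum>i\<in>UNIV. s $ i * x $ i)) \<partial>\<mu>) = (\<integral>x. exp (- (\<Sum>i\<in>UNIV. s $ i * x $ i)) \<partial>\<nu>)"
  shows "\<mu> = \<nu>"
proof -
  interpret mu: prob_space \<mu> by fact
  interpret nu: prob_space \<nu> by fact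
  have span_eq: "(\<integral>x. g (exp_neg x) \<partial>\<mu>) = (\<integral>x. g (exp_neg x) \<partial>\<nu>)" if "monomial_span g" for g
    using that
  proof (induction rule: monomial_span.induct)
    case (monomial c m)
    have "(\<Prod>i\<in>UNIV. exp_neg x $ i ^ m i) = exp (- (\<Sum>i\<in>UNIV. (\<chi> i. real (m i)) $ i * x $ i))" for x :: "real^'n"
      by (simp add: exp_neg_def exp_sum sum_negf[symmetric] exp_of_nat_mult[symmetric])
    then show ?case using eq[of "\<chi> i. real (m i)"] by simp
  next
    case (add f g)
    then show ?case
      by (simp add: integrable_exp_neg_comp mu nu sets_mu sets_nu pos_mu pos_nu continuous_on_monomial_span)
  qed
  have "distr \<mu> borel exp_neg = distr \<nu> borel exp_neg"
  proof (rule measure_eqI_integral_continuous)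
    show "prob_space (distr \<mu> borel exp_neg)" by (rule mu.prob_space_distr) measurable
    show "prob_space (distr \<nu> borel exp_neg)" by (rule nu.prob_space_distr) measurable
    fix f :: "real^'n \<Rightarrow> real" assume f: "continuous_on UNIV f"
    have [measurable]: "f \<in> borel_measurable borel" by (intro borel_measurable_continuous_onI f)
    have "\<bar>(\<integral>x. f (exp_neg x) \<partial>\<mu>) - (\<integral>x. f (exp_neg x) \<partial>\<nu>)\<bar> \<le> e" if "0 < e" for e
    proof -
      have "continuous_on (cbox 0 (\<chi> i. 1)) f" "0 < e / 2" using f that continuous_on_subset by auto
      with monomial_span_dense[OF compact_cbox] obtain g where g: "monomial_span g"
        and fg: "\<And>y. y \<in> cbox 0 (\<chi> i. 1) \<Longrightarrow> \<bar>f y - g y\<bar> < e / 2" by metis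
      \<comment> \<open>Replacing \<open>f\<close> by its polynomial approximation costs at most
        \<open>e / 2\<close> under each of the two measures, and the integrals of the polynomial
        agree.\<close>
      have close: "\<bar>(\<integral>x. f (exp_neg x) \<partial>M) - (\<integral>x. g (exp_neg x) \<partial>M)\<bar> \<le> e / 2"
        if M: "prob_space M" "sets M = sets borel" "AE x in M. \<forall>i. 0 \<le> x $ i" for M
      proof -
        interpret prob_space M by fact
        note int = integrable_exp_neg_comp[OF M f]
          integrable_exp_neg_comp[OF M continuous_on_monomial_span[OF g]]
        have "\<bar>\<integral>x. f (exp_neg x) - g (exp_neg x) \<partial>M\<bar> \<le> (\<integral>x. \<bar>f (exp_neg x) - g (exp_neg x)\<bar> \<partial>M)"
          by (rule integral_abs_bound)
        also have "\<dots> \<le> (\<integral>x. e / 2 \<partial>M)"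
        proof (rule integral_mono_AE)
          show "AE x in M. \<bar>f (exp_neg x) - g (exp_neg x)\<bar> \<le> e / 2"
            using M(3) by eventually_elim (use less_imp_le[OF fg[OF exp_neg_mem_cbox]] in blast)
        qed (use int in auto)
        finally show ?thesis using int by (simp add: prob_space)
      qed
      show ?thesis
        using close[OF mu sets_mu pos_mu] close[OF nu sets_nu pos_nu] span_eq[OF g] by linarith
    qed
    then have "\<bar>(\<integral>x. f (exp_neg x) \<partial>\<mu>) - (\<integral>x. f (exp_neg x) \<partial>\<nu>)\<bar> \<le> 0"
      by (rule field_le_epsilon) simp
    then show "(\<integral>x. f x \<partial>distr \<mu> borel exp_neg) = (\<integral>x. f x \<partial>distr \<nu> borel exp_neg)"
      by (simp add: integral_distr)
  qed simp_all
  \<comment> \<open>Taking \<open>- ln\<close> coordinatewise is a left inverse of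
    \<open>exp_neg\<close>, so the image law determines the original one.\<close>
  moreover have "distr (distr M borel exp_neg) borel (\<lambda>y. \<chi> i. - ln (y $ i)) = M"
    if [measurable_cong]: "sets M = sets borel" for M :: "(real^'n) measure"
  proof -
    have [measurable]: "(\<lambda>y :: real^'n. \<chi> i. - ln (y $ i)) \<in> borel_measurable borel"
      by measurable
    have "(\<lambda>y :: real^'n. \<chi> i. - ln (y $ i)) \<circ> exp_neg = (\<lambda>x. x)"
      by (auto simp: exp_neg_def vec_eq_iff)
    then show ?thesis
      by (subst distr_distr) (auto intro!: distr_id2 simp: that)
  qed
  ultimately show ?thesis using sets_mu sets_nu by metis
qed

section \<open>Gamma laws\<close>

lemma gamma_density_nonneg: "0 < u \<Longrightarrow> 0 \<le> v \<Longrightarrow> 0 \<le> gamma_density u v x"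
  by (simp add: gamma_density_def less_imp_le)

lemma measurable_gamma_density [measurable]: "gamma_density u v \<in> borel_measurable borel"
  unfolding gamma_density_def by measurable

text \<open>The substitution \<open>y = (1 + t) x\<close> turns the integral into Euler's integral
  for \<open>Gamma u\<close>.\<close>

lemma nn_integral_gamma_density_exp:
  assumes u: "0 < u" and t: "0 \<le> t"
  shows "(\<integral>\<^sup>+x. ennreal (gamma_density u 1 x) * ennreal (exp (- (t * x))) \<partial>lborel) = ennreal ((1 / (1 + t)) powr u)"
proof -
  let ?g = "\<lambda>y. indicator {0..} y * y powr (u - 1) / exp y :: real"
  have G: "0 < Gamma u" using u by (rule Gamma_real_pos)
  \<comment> \<open>The factor \<open>\<bar>1 + t\<bar>\<close> and the argument
    \<open>0 + (1 + t) * x\<close> give the shape required by the affine substitution rule.\<close>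
  have eq: "ennreal (gamma_density u 1 x) * ennreal (exp (- (t * x)))
      = ennreal ((1 / (1 + t)) powr u / Gamma u) * (ennreal \<bar>1 + t\<bar> * ennreal (?g (0 + (1 + t) * x)))" for x
  proof (cases "0 < x")
    case True
    define c where "c = 1 + t"
    have c: "0 < c" using t by (simp add: c_def)
    have "(1 / c) powr u * c powr u = 1"
      using c by (simp add: powr_divide)
    then have "(1 / c) powr u * (c * (c * x) powr (u - 1)) = x powr (u - 1)"
      using c True by (simp add: powr_mult powr_diff)
    moreover have "exp (c * x) = exp x * exp (t * x)"
      by (simp add: c_def distrib_right exp_add)
    moreover have "(1 / c) powr u / Gamma u * (\<bar>c\<bar> * ?g (c * x))
        = ((1 / c) powr u * (c * (c * x) powr (u - 1))) / (Gamma u * exp (c * x))"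
      using c True by simp
    ultimately have "gamma_density u 1 x * exp (- (t * x)) = (1 / c) powr u / Gamma u * (\<bar>c\<bar> * ?g (c * x))"
      using True G by (simp add: gamma_density_def exp_minus divide_inverse)
    then have "gamma_density u 1 x * exp (- (t * x))
      = (1 / (1 + t)) powr u / Gamma u * (\<bar>1 + t\<bar> * ?g ((1 + t) * x))"
      by (simp only: c_def)
    moreover have "0 \<le> ?g ((1 + t) * x)" by simp
    moreover have "ennreal (a * (b * c)) = ennreal a * (ennreal b * ennreal c)"
      if "0 \<le> a" "0 \<le> b" "0 \<le> c" for a b c using that by (simp add: ennreal_mult)
    ultimately have "ennreal (gamma_density u 1 x * exp (- (t * x)))
        = ennreal ((1 / (1 + t)) powr u / Gamma u) * (ennreal \<bar>1 + t\<bar> * ennreal (?g ((1 + t) * x)))"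
      using G by (metis abs_ge_zero divide_nonneg_pos powr_ge_zero)
    then show ?thesis
      using gamma_density_nonneg[OF u, of 1 x] by (simp only: ennreal_mult add_0) (simp add: ennreal_mult)
  next
    case False
    \<comment> \<open>At \<open>x = 0\<close> the indicator equals 1 and the value vanishes through
      \<open>0 powr (u - 1) = 0\<close>; for negative \<open>x\<close> the indicator is 0.\<close>
    have "?g ((1 + t) * x) = 0"
      using t False by (cases "x = 0") (auto simp: indicator_def zero_le_mult_iff)
    then show ?thesis using False by (simp add: gamma_density_def)
  qed
  have "(\<integral>\<^sup>+x. ennreal (gamma_density u 1 x) * ennreal (exp (- (t * x))) \<partial>lborel)
      = ennreal ((1 / (1 + t)) powr u / Gamma u) * (ennreal \<bar>1 + t\<bar> * (\<integral>\<^sup>+x. ennreal (?g (0 + (1 + t) * x)) \<partial>lborel))"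
    unfolding eq by (subst nn_integral_cmult, measurable)+
  also have "ennreal \<bar>1 + t\<bar> * (\<integral>\<^sup>+x. ennreal (?g (0 + (1 + t) * x)) \<partial>lborel) = (\<integral>\<^sup>+y. ennreal (?g y) \<partial>lborel)"
    using t by (intro nn_integral_real_affine[symmetric]) auto
  also have "\<dots> = ennreal (Gamma u)"
    by (rule Gamma_conv_nn_integral_real[OF u, symmetric])
  also have "ennreal ((1 / (1 + t)) powr u / Gamma u) * ennreal (Gamma u) = ennreal ((1 / (1 + t)) powr u)"
    using G by (simp add: ennreal_mult[symmetric])
  finally show ?thesis .
qed

text \<open>Shape 0 is the unit mass at 0, the limiting case in which the transform
  \<open>(1 / (1 + t)) powr u\<close> remains valid. It occurs when a coordinate of the random
  multi-index is 0.\<close>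

definition gamma_law :: "real \<Rightarrow> real measure" where
  "gamma_law u = (if u = 0 then return borel 0 else density lborel (\<lambda>x. ennreal (gamma_density u 1 x)))"

lemma sets_gamma_law [measurable_cong, simp]: "sets (gamma_law u) = sets borel"
  by (simp add: gamma_law_def)

lemma space_gamma_law [simp]: "space (gamma_law u) = UNIV"
  by (simp add: gamma_law_def)

lemma laplace_gamma_law:
  assumes "0 \<le> u" "0 \<le> t"
  shows "(\<integral>\<^sup>+x. ennreal (exp (- (t * x))) \<partial>gamma_law u) = ennreal ((1 / (1 + t)) powr u)"
  using assms nn_integral_gamma_density_exp[of u t]
  by (auto simp: gamma_law_def nn_integral_density nn_integral_return)

text \<open>The total mass is the Laplace transform at \<open>t = 0\<close>.\<close>

lemma prob_space_gamma_law: "0 \<le> u \<Longrightarrow> prob_space (gamma_law u)"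
  using laplace_gamma_law[of u 0] by (intro prob_spaceI) simp

lemma AE_gamma_law_nonneg: "AE x in gamma_law u. 0 \<le> x"
proof (cases "u = 0")
  case True
  then have "gamma_law u = return borel 0" by (simp add: gamma_law_def)
  then show ?thesis by (simp only:) (subst AE_return, auto)
next
  case False
  then have "gamma_law u = density lborel (\<lambda>x. ennreal (gamma_density u 1 x))"
    by (simp add: gamma_law_def)
  then show ?thesis
    by (simp only:) (subst AE_density, auto simp: gamma_density_def)
qed

section \<open>Vectors with independent gamma coordinates\<close>

definition gamma_vector_law :: "('n \<Rightarrow> real) \<Rightarrow> (real^'n) measure" where
  "gamma_vector_law u = distr (\<Pi>\<^sub>M i\<in>UNIV. gamma_law (u i)) borel (\<lambda>x. \<chi> i. x i)"

lemma borel_measurable_vec_nth_comp [measurable (raw)]: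
  "f \<in> borel_measurable M \<Longrightarrow> (\<lambda>x. f x $ i :: real) \<in> borel_measurable M"
  by (rule borel_measurable_continuous_on[of "\<lambda>x. x $ i"]) (auto intro: continuous_intros)

context
  fixes u :: "'n::finite \<Rightarrow> real"
  assumes u: "\<And>i. 0 \<le> u i"
begin

interpretation product_prob_space "\<lambda>i. gamma_law (u i)" UNIV
  by (intro product_prob_spaceI prob_space_gamma_law u)

lemma measurable_gamma_vector [measurable]:
  "(\<lambda>x. \<chi> i. x i) \<in> (\<Pi>\<^sub>M i\<in>UNIV. gamma_law (u i)) \<rightarrow>\<^sub>M borel"
  by measurable

lemma sets_gamma_vector_law: "sets (gamma_vector_law u) = sets borel"
  by (simp add: gamma_vector_law_def)

lemma prob_space_gamma_vector_law: "prob_space (gamma_vector_law u)"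
  unfolding gamma_vector_law_def by (intro prob_space_distr) measurable

lemma distr_gamma_vector_law_component: "distr (gamma_vector_law u) borel (\<lambda>x. x $ i) = gamma_law (u i)"
proof -
  have "distr (gamma_vector_law u) borel (\<lambda>x. x $ i)
      = distr (\<Pi>\<^sub>M i\<in>UNIV. gamma_law (u i)) borel (\<lambda>x. x i)"
    unfolding gamma_vector_law_def by (subst distr_distr) (simp_all add: comp_def)
  also have "\<dots> = distr (\<Pi>\<^sub>M i\<in>UNIV. gamma_law (u i)) (gamma_law (u i)) (\<lambda>x. x i)"
    by (intro distr_cong) simp_all
  also have "\<dots> = gamma_law (u i)" by (intro PiM_component) simp
  finally show ?thesis .
qed

lemma AE_gamma_vector_law_nonneg: "AE x in gamma_vector_law u. \<forall>i. 0 \<le> x $ i"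
proof -
  have "AE x in gamma_vector_law u. 0 \<le> x $ i" for i
  proof -
    have "AE y in distr (gamma_vector_law u) borel (\<lambda>x. x $ i). 0 \<le> y"
      unfolding distr_gamma_vector_law_component by (rule AE_gamma_law_nonneg)
    then show ?thesis
      by (subst (asm) AE_distr_iff) (auto simp: gamma_vector_law_def)
  qed
  then show ?thesis by (simp add: AE_all_countable)
qed

lemma laplace_gamma_vector_law:
  assumes t: "\<And>i. 0 \<le> t $ i"
  shows "(\<integral>\<^sup>+x. ennreal (exp (- (\<Sum>i\<in>UNIV. t $ i * x $ i))) \<partial>gamma_vector_law u)
    = (\<Prod>i\<in>UNIV. ennreal ((1 / (1 + t $ i)) powr u i))"
proof -
  have "(\<integral>\<^sup>+x. ennreal (exp (- (\<Sum>i\<in>UNIV. t $ i * x $ i))) \<partial>gamma_vector_law u)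
      = (\<integral>\<^sup>+x. (\<Prod>i\<in>UNIV. ennreal (exp (- (t $ i * x i)))) \<partial>(\<Pi>\<^sub>M i\<in>UNIV. gamma_law (u i)))"
    unfolding gamma_vector_law_def
    by (subst nn_integral_distr) (simp_all add: sum_negf[symmetric] exp_sum prod_ennreal)
  also have "\<dots> = (\<Prod>i\<in>UNIV. \<integral>\<^sup>+x. ennreal (exp (- (t $ i * x))) \<partial>gamma_law (u i))"
    by (rule product_nn_integral_prod) auto
  also have "\<dots> = (\<Prod>i\<in>UNIV. ennreal ((1 / (1 + t $ i)) powr u i))"
    using t u by (simp add: laplace_gamma_law)
  finally show ?thesis .
qed

text \<open>Unpacking a vector into its coordinates undoes the packing in
  \<open>gamma_vector_law\<close>, so their joint law is the product measure, which is the product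
  of the marginals.\<close>

lemma indep_vars_gamma_vector_law:
  "prob_space.indep_vars (gamma_vector_law u) (\<lambda>_. borel) (\<lambda>i x. x $ i) UNIV"
proof -
  interpret G: prob_space "gamma_vector_law u" by (rule prob_space_gamma_vector_law)
  let ?P = "\<Pi>\<^sub>M i\<in>UNIV. gamma_law (u i)"
  have sets: "sets (\<Pi>\<^sub>M i\<in>UNIV. borel) = sets ?P"
    by (intro sets_PiM_cong) simp_all
  have "distr (gamma_vector_law u) (\<Pi>\<^sub>M i\<in>UNIV. borel) (\<lambda>x. \<lambda>i\<in>UNIV. x $ i)
      = distr ?P (\<Pi>\<^sub>M i\<in>UNIV. borel) (\<lambda>x. x)"
  proof -
    have "(\<lambda>x. \<lambda>i\<in>UNIV. x $ i) \<in> (borel :: (real^'n) measure) \<rightarrow>\<^sub>M (\<Pi>\<^sub>M i\<in>UNIV. borel)"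
      by (intro measurable_restrict) measurable
    from distr_distr[OF this measurable_gamma_vector] show ?thesis
      by (simp add: gamma_vector_law_def comp_def restrict_UNIV vec_lambda_inverse)
  qed
  also have "\<dots> = ?P" by (intro distr_id2 sets)
  finally have "distr (gamma_vector_law u) (\<Pi>\<^sub>M i\<in>UNIV. borel) (\<lambda>x. \<lambda>i\<in>UNIV. x $ i)
      = (\<Pi>\<^sub>M i\<in>UNIV. distr (gamma_vector_law u) borel (\<lambda>x. x $ i))"
    by (simp add: distr_gamma_vector_law_component)
  then show ?thesis
    by (subst G.indep_vars_iff_distr_eq_PiM) (auto simp: gamma_vector_law_def)
qed

end

lemma iid_gamma_vector_law:
  assumes "0 < \<alpha>"
  shows "iid_gamma \<alpha> 1 (gamma_vector_law (\<lambda>_ :: 'n::finite. \<alpha>)) (\<lambda>i x. x $ i)"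
proof -
  let ?N = "gamma_vector_law (\<lambda>_ :: 'n. \<alpha>)"
  have "distr ?N lborel (\<lambda>x. x $ i) = distr ?N borel (\<lambda>x. x $ i)" for i
    by (intro distr_cong) simp_all
  also have "\<dots> i = density lborel (\<lambda>x. ennreal (gamma_density \<alpha> 1 x))" for i
    using assms by (subst distr_gamma_vector_law_component) (auto simp: gamma_law_def)
  finally have "distributed ?N lborel (\<lambda>x. x $ i) (\<lambda>x. ennreal (gamma_density \<alpha> 1 x))" for i
    unfolding distributed_def by (simp add: gamma_vector_law_def)
  then show ?thesis
    using assms by (simp add: iid_gamma_def prob_space_gamma_vector_law indep_vars_gamma_vector_law)
qed

text \<open>Draw \<open>j\<close> from \<open>p\<close> and then independent gamma coordinates with
  shapes \<open>m j i\<close>. Each conditional transform is a monomial in the numbers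
  \<open>1 / (1 + t $ i)\<close>, so averaging over \<open>j\<close> reproduces the generating
  function.\<close>

lemma mixed_gamma_law_exists:
  fixes m :: "nat \<Rightarrow> 'n::finite \<Rightarrow> nat" and p :: "nat pmf"
  obtains \<nu> :: "(real^'n) measure"
  where "prob_space \<nu>" "sets \<nu> = sets borel" "AE x in \<nu>. \<forall>i. 0 \<le> x $ i"
    and "\<And>t. (\<And>i. 0 \<le> t $ i) \<Longrightarrow> (\<integral>\<^sup>+x. ennreal (exp (- (\<Sum>i\<in>UNIV. t $ i * x $ i))) \<partial>\<nu>)
      = (\<integral>\<^sup>+j. (\<Prod>i\<in>UNIV. ennreal (1 / (1 + t $ i)) ^ m j i) \<partial>measure_pmf p)"
proof -
  let ?G = "\<lambda>j. gamma_vector_law (\<lambda>i. real (m j i))"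
  have kernel: "?G \<in> measure_pmf p \<rightarrow>\<^sub>M subprob_algebra borel"
    by (auto simp: measurable_def space_subprob_algebra sets_gamma_vector_law
        intro!: prob_space_imp_subprob_space prob_space_gamma_vector_law)
  show ?thesis
  proof (rule that)
    show "prob_space (measure_pmf p \<bind> ?G)"
      by (rule measure_pmf.prob_space_bind[OF _ kernel]) (simp add: prob_space_gamma_vector_law)
    show "sets (measure_pmf p \<bind> ?G) = sets borel"
      by (rule sets_bind) (simp_all add: sets_gamma_vector_law)
    show "AE x in measure_pmf p \<bind> ?G. \<forall>i. 0 \<le> x $ i"
      by (subst AE_bind[OF kernel]) (auto intro!: AE_I2 AE_gamma_vector_law_nonneg)
    fix t :: "real^'n" assume t: "\<And>i. 0 \<le> t $ i"
    have "(\<integral>\<^sup>+x. ennreal (exp (- (\<Sum>i\<in>UNIV. t $ i * x $ i))) \<partial>(measure_pmf p \<bind> ?G))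
        = (\<integral>\<^sup>+j. \<integral>\<^sup>+x. ennreal (exp (- (\<Sum>i\<in>UNIV. t $ i * x $ i))) \<partial>?G j \<partial>measure_pmf p)"
      by (rule nn_integral_bind[OF _ kernel]) measurable
    also have "\<dots> = (\<integral>\<^sup>+j. (\<Prod>i\<in>UNIV. ennreal (1 / (1 + t $ i)) ^ m j i) \<partial>measure_pmf p)"
    proof (intro nn_integral_cong)
      fix j
      have "1 / (1 + t $ i) > 0" for i using t[of i] by simp
      then show "(\<integral>\<^sup>+x. ennreal (exp (- (\<Sum>i\<in>UNIV. t $ i * x $ i))) \<partial>?G j) =
          (\<Prod>i\<in>UNIV. ennreal (1 / (1 + t $ i)) ^ m j i)"
        using t by (subst laplace_gamma_vector_law) (auto simp: powr_realpow ennreal_power less_imp_le)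
    qed
    finally show "(\<integral>\<^sup>+x. ennreal (exp (- (\<Sum>i\<in>UNIV. t $ i * x $ i))) \<partial>(measure_pmf p \<bind> ?G))
        = (\<integral>\<^sup>+j. (\<Prod>i\<in>UNIV. ennreal (1 / (1 + t $ i)) ^ m j i) \<partial>measure_pmf p)" .
  qed
qed

section \<open>The coupling\<close>

theorem theorem1p1:
  fixes \<alpha> :: real and K A :: "real ^ 'n ^ 'n"
    and M :: "'a measure" and X :: "'a \<Rightarrow> real ^ 'n"
  assumes "0 < \<alpha>"
    and "permanental_vector \<alpha> K M X"
    and "invertible K"
    and "A = matrix_inv K"
    and "nonsingular_M_matrix A"
  shows "\<exists>(N :: (real ^ 'n) measure) (\<xi> :: 'n \<Rightarrow> real ^ 'n \<Rightarrow> real).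
           iid_gamma \<alpha> 1 N \<xi> \<and>
           (\<exists>(P :: ((real ^ 'n) \<times> (real ^ 'n)) measure) X' Y'.
              coupling M X N (\<lambda>\<omega>. \<chi> i. \<xi> i \<omega>) P X' Y' \<and>
              (AE \<omega> in P. \<forall>i. X' \<omega> $ i \<ge> inverse (A $ i $ i) * Y' \<omega> $ i))"
proof -
  let ?L = "log_det_series (jacobi_matrix A)" and ?one = "(\<chi> i. 1) :: real^'n"
  have pos: "0 < A $ i $ i" for i by (rule M_matrix_diag_pos[OF assms(5)])
  note C = jacobi_matrix_nonneg[OF assms(5)] summable_mpow_jacobi_matrix[OF assms(5)]
  interpret M: prob_space M
    using assms(2) by (simp add: permanental_vector_def)
  have X_meas [measurable]: "X \<in> borel_measurable M" and X_nonneg: "AE \<omega> in M. \<forall>i. 0 \<le> X \<omega> $ i"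
    and X_laplace: "\<And>s. (\<And>i. 0 \<le> s $ i) \<Longrightarrow> (\<integral>\<omega>. exp (- (\<Sum>i\<in>UNIV. s $ i * X \<omega> $ i)) \<partial>M)
          = det (mat 1 + K ** diag_matrix s) powr (- \<alpha>)"
    using assms(2) by (simp_all add: permanental_vector_def)

  \<comment> \<open>The transform of the summand \<open>\<eta>\<close> as a function of
    \<open>z\<close>. The constant \<open>exp (- \<alpha> L(1))\<close> is kept as a separate
    factor, because closure under \<open>exp\<close> covers only non-negative exponents.\<close>
  define f where "f z = ennreal (exp (\<alpha> * ?L z)) * ennreal (exp (- (\<alpha> * ?L ?one)))" for z
  have "nonneg_power_series (\<lambda>z. ennreal \<alpha> * ennreal (?L z))"
    by (intro nonneg_power_series_mult nonneg_power_series_const nonneg_power_series_log_det C)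
  then have "nonneg_power_series (\<lambda>z. ennreal (\<alpha> * ?L z))"
    by (rule nonneg_power_series_cong)
       (use assms(1) log_det_series_nonneg[OF C] in \<open>simp add: ennreal_mult\<close>)
  then have f_series: "nonneg_power_series f"
    unfolding f_def
    by (intro nonneg_power_series_mult nonneg_power_series_const nonneg_power_series_exp)
       (use assms(1) log_det_series_nonneg[OF C] in auto)
  have f_one: "f ?one = 1"
    by (simp add: f_def ennreal_mult[symmetric] exp_add[symmetric])
  obtain p :: "nat pmf" and m where pm: "\<And>z. (\<And>i. 0 \<le> z $ i) \<Longrightarrow> (\<And>i. z $ i \<le> 1) \<Longrightarrow>
     (\<integral>\<^sup>+j. (\<Prod>i\<in>UNIV. ennreal (z $ i) ^ m j i) \<partial>measure_pmf p) = f z"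
    using nonneg_power_series_pmf[OF f_series f_one] by blast
  obtain \<nu> :: "(real^'n) measure"
    where nu: "prob_space \<nu>" and sets_nu [measurable_cong]: "sets \<nu> = sets borel"
      and nu_nonneg: "AE x in \<nu>. \<forall>i. 0 \<le> x $ i"
      and nu_laplace: "\<And>t. (\<And>i. 0 \<le> t $ i) \<Longrightarrow> (\<integral>\<^sup>+x. ennreal (exp (- (\<Sum>i\<in>UNIV. t $ i * x $ i))) \<partial>\<nu>)
      = (\<integral>\<^sup>+j. (\<Prod>i\<in>UNIV. ennreal (1 / (1 + t $ i)) ^ m j i) \<partial>measure_pmf p)"
    using mixed_gamma_law_exists[of p m] by blast
  interpret nu: prob_space \<nu> by fact

  \<comment> \<open>The i.i.d. gamma variables will be the coordinate projections on
    \<open>N\<close>, which is also the first factor of the common space \<open>P\<close>.\<close>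
  define N where "N = gamma_vector_law (\<lambda>_ :: 'n. \<alpha>)"
  have sets_N [measurable_cong]: "sets N = sets borel" and prob_N: "prob_space N"
    using assms(1) by (simp_all add: N_def sets_gamma_vector_law prob_space_gamma_vector_law)
  have N_nonneg: "AE x in N. \<forall>i. 0 \<le> x $ i"
    unfolding N_def using assms(1) by (intro AE_gamma_vector_law_nonneg) simp
  interpret N: prob_space N by (rule prob_N)
  define P where "P = N \<Otimes>\<^sub>M \<nu>"
  interpret P: pair_prob_space N \<nu> ..
  have [measurable_cong]: "sets P = sets (borel \<Otimes>\<^sub>M borel)"
    unfolding P_def by (intro sets_pair_measure_cong sets_N sets_nu)
  have prob_P: "prob_space P" unfolding P_def by (rule P.prob_space_axioms)
  \<comment> \<open>Both components have unit scale; dividing their sum by \<open>A $ i $ i\<close>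
    yields \<open>\<xi>\<^sub>i / a\<^sub>i + \<eta>\<^sub>i\<close>.\<close>
  define X' :: "(real^'n) \<times> (real^'n) \<Rightarrow> real^'n"
    where "X' \<omega> = (\<chi> i. (fst \<omega> $ i + snd \<omega> $ i) / A $ i $ i)" for \<omega>
  have X'_meas [measurable]: "X' \<in> borel_measurable P"
    unfolding X'_def by measurable
  have fst_law: "distr P borel fst = N"
    using nu.distr_pair_fst[of N] sets_N by (simp add: P_def cong: distr_cong)
  have snd_law: "distr P borel snd = \<nu>"
  proof (rule measure_eqI)
    fix B assume "B \<in> sets (distr P borel snd)"
    then have B: "B \<in> sets \<nu>" by (simp add: sets_nu)
    then have "emeasure (distr P borel snd) B = emeasure P (space N \<times> B)"
      using sets.sets_into_space[OF B]
      by (subst emeasure_distr) (auto simp: sets_nu P_def space_pair_measure intro!: arg_cong2[where f = emeasure])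
    then show "emeasure (distr P borel snd) B = emeasure \<nu> B"
      using B by (simp add: P_def nu.emeasure_pair_measure_Times N.emeasure_space_1)
  qed (simp add: sets_nu)
  have fst_nonneg: "AE \<omega> in P. \<forall>i. 0 \<le> fst \<omega> $ i"
    using N_nonneg unfolding fst_law[symmetric] by (subst (asm) AE_distr_iff) auto
  have snd_nonneg: "AE \<omega> in P. \<forall>i. 0 \<le> snd \<omega> $ i"
    using nu_nonneg unfolding snd_law[symmetric] by (subst (asm) AE_distr_iff) auto
  have X'_law: "distr P borel X' = distr M borel X"
  proof (rule measure_eqI_laplace)
    show "prob_space (distr P borel X')" by (rule prob_space.prob_space_distr[OF prob_P X'_meas])
    show "prob_space (distr M borel X)" by (rule M.prob_space_distr[OF X_meas])
    have "AE \<omega> in P. \<forall>i. 0 \<le> X' \<omega> $ i"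
      using fst_nonneg snd_nonneg by eventually_elim (use pos in \<open>simp add: X'_def less_imp_le\<close>)
    then show "AE x in distr P borel X'. \<forall>i. 0 \<le> x $ i"
      by (subst AE_distr_iff) auto
    show "AE x in distr M borel X. \<forall>i. 0 \<le> x $ i"
      using X_nonneg by (subst AE_distr_iff) auto
    fix s :: "real^'n" assume s: "\<And>i. 0 \<le> s $ i"
    \<comment> \<open>Dividing the coordinates by \<open>A $ i $ i\<close> amounts to evaluating the
      transforms of \<open>N\<close> and \<open>\<nu>\<close> at \<open>t\<close>; then
      \<open>z $ i\<close> is the transform of a unit exponential variable at
      \<open>t $ i\<close>.\<close>
    define t where "t = (\<chi> i. s $ i / A $ i $ i)"
    define z where "z = (\<chi> i. 1 / (1 + s $ i / A $ i $ i))"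
    have t: "0 \<le> t $ i" for i using s pos[of i] by (simp add: t_def)
    have z_eq: "z $ i = 1 / (1 + t $ i)" for i by (simp add: z_def t_def)
    have z: "0 < z $ i" "z $ i \<le> 1" for i using t[of i] by (simp_all add: z_eq)
    let ?e = "\<lambda>x. ennreal (exp (- (\<Sum>i\<in>UNIV. t $ i * x $ i)))"
    have "(\<integral>\<^sup>+\<omega>. ennreal (exp (- (\<Sum>i\<in>UNIV. s $ i * X' \<omega> $ i))) \<partial>P)
        = (\<integral>\<^sup>+(x, y). ?e x * ?e y \<partial>(N \<Otimes>\<^sub>M \<nu>))"
      unfolding P_def
      by (intro nn_integral_cong)
         (auto simp: X'_def t_def ennreal_mult[symmetric] exp_add[symmetric] sum.distrib
            add_divide_distrib distrib_left)
    also have "\<dots> = (\<integral>\<^sup>+x. \<integral>\<^sup>+y. ?e x * ?e y \<partial>\<nu> \<partial>N)"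
      by (subst nu.nn_integral_fst[symmetric]) auto
    also have "\<dots> = (\<integral>\<^sup>+x. ?e x \<partial>N) * (\<integral>\<^sup>+y. ?e y \<partial>\<nu>)"
      by (simp add: nn_integral_cmult nn_integral_multc)
    also have "(\<integral>\<^sup>+x. ?e x \<partial>N) = (\<Prod>i\<in>UNIV. ennreal (z $ i powr \<alpha>))"
      unfolding N_def z_eq using assms(1) t by (intro laplace_gamma_vector_law) auto
    also have "\<dots> = ennreal ((\<Prod>i\<in>UNIV. z $ i) powr \<alpha>)"
      using z by (simp add: prod_ennreal prod_powr_distrib less_imp_le)
    also have "(\<integral>\<^sup>+y. ?e y \<partial>\<nu>) = f z"
      using pm[of z] z nu_laplace[OF t] by (simp add: z_eq less_imp_le)
    \<comment> \<open>The two factors recombine into a single power with exponent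
      \<open>- \<alpha>\<close>, whose base is the expression in
      \<open>det_permanental\<close>.\<close>
    also have "ennreal ((\<Prod>i\<in>UNIV. z $ i) powr \<alpha>) * f z
        = ennreal ((exp (?L ?one - ?L z) / (\<Prod>i\<in>UNIV. z $ i)) powr (- \<alpha>))"
    proof -
      have Pz: "0 < (\<Prod>i\<in>UNIV. z $ i)" using z by (intro prod_pos) auto
      have "(exp (?L ?one - ?L z) / (\<Prod>i\<in>UNIV. z $ i)) powr (- \<alpha>)
          = exp (?L ?one - ?L z) powr (- \<alpha>) / (\<Prod>i\<in>UNIV. z $ i) powr (- \<alpha>)"
        by (rule powr_divide)
      also have "\<dots> = (\<Prod>i\<in>UNIV. z $ i) powr \<alpha> * exp ((?L ?one - ?L z) * - \<alpha>)"
        by (simp add: exp_powr_real powr_minus exp_minus divide_inverse mult.commute)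
      also have "(?L ?one - ?L z) * - \<alpha> = \<alpha> * ?L z + - (\<alpha> * ?L ?one)"
        by (simp add: algebra_simps)
      finally have "(exp (?L ?one - ?L z) / (\<Prod>i\<in>UNIV. z $ i)) powr (- \<alpha>)
          = (\<Prod>i\<in>UNIV. z $ i) powr \<alpha> * (exp (\<alpha> * ?L z) * exp (- (\<alpha> * ?L ?one)))"
        by (simp only: exp_add)
      then show ?thesis
        by (simp add: f_def ennreal_mult[symmetric])
    qed
    also have "exp (?L ?one - ?L z) / (\<Prod>i\<in>UNIV. z $ i) = det (mat 1 + K ** diag_matrix s)"
      by (rule det_permanental[OF assms(3,4,5) s z_def, symmetric])
    finally have "(\<integral>\<omega>. exp (- (\<Sum>i\<in>UNIV. s $ i * X' \<omega> $ i)) \<partial>P) = det (mat 1 + K ** diag_matrix s) powr (- \<alpha>)"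
      by (subst integral_eq_nn_integral) auto
    then show "(\<integral>x. exp (- (\<Sum>i\<in>UNIV. s $ i * x $ i)) \<partial>distr P borel X')
        = (\<integral>x. exp (- (\<Sum>i\<in>UNIV. s $ i * x $ i)) \<partial>distr M borel X)"
      by (simp add: integral_distr X_laplace s)
  qed simp_all

  \<comment> \<open>\<open>fst\<close> serves as \<open>Y'\<close>, since the vector of coordinate
    projections is the identity.\<close>
  have "coupling M X N (\<lambda>\<omega>. \<chi> i. \<omega> $ i) P X' fst"
    using prob_P X'_law fst_law
    by (simp add: coupling_def distr_id2[OF sets_N[symmetric]] sets_N)
  \<comment> \<open>The difference of the two sides is \<open>snd \<omega> $ i / A $ i $ i\<close>,
    hence non-negative almost surely.\<close>
  moreover have "AE \<omega> in P. \<forall>i. X' \<omega> $ i \<ge> inverse (A $ i $ i) * fst \<omega> $ i"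
    using snd_nonneg by eventually_elim (use pos in \<open>simp add: X'_def field_simps less_imp_neq[THEN not_sym]\<close>)
  ultimately show ?thesis
    using iid_gamma_vector_law[OF assms(1), where 'n = 'n] unfolding N_def by blast
qed

end
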